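(* Suppose the forward operator and input assumption and the fourth-moment condition (with constant $\kappa\ge1$) described in the context hold. Then for all $n\ge1$, all $M\ge1$ and all $\epsilon>0$, the smallest eigenvalue $\widehat\lambda_{\min}=\lambda_{\min}(\overline A_{n,M})$ of the empirical normal matrix satisfies $$\mathbb P\Big\{\widehat\lambda_{\min}\le\frac{3-\epsilon}{8}\lambda_n\Big\}\le\frac{\kappa\lambda_1^2}{M}+\exp\Big(n\log\Big(\frac{20(\lambda_1+1)}{\lambda_n}\Big)-\frac{\epsilon M\lambda_n}{4\kappa(\lambda_n+\lambda_1)}\Big).$$ In particular, for $\epsilon=1$, $$\mathbb P\Big\{\widehat\lambda_{\min}\le\frac{\lambda_n}{4}\Big\}\le\frac{\kappa\lambda_1^2}{M}+\exp\Big(n\log\Big(\frac{20(\lambda_1+1)}{\lambda_n}\Big)-\frac{M\lambda_n}{4\kappa(\lambda_n+\lambda_1)}\Big).$$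
   Context: Setting. $\mathcal S\subset\mathbb R^d$ is compact, $\rho$ is a Borel measure on $\mathcal S$, $L^2_\rho=L^2(\mathcal S,\mathcal B(\mathcal S),\rho)$; $\mathbb X$ is a Banach space, $\mathbb Y$ a separable real Hilbert space. For every $\phi\in L^2_\rho$, $R_\phi:\mathbb X\to\mathbb Y$ is a measurable, possibly nonlinear, map; $u$ is an $\mathbb X$-valued random variable, and $u^1,\dots,u^M$ are i.i.d. copies of $u$. Forward operator and input assumption. (1) $R_\phi[u]$ is linear in $\phi$ for each $u\in\mathbb X$. (2) The normal operator $\mathcal L:L^2_\rho\to L^2_\rho$ defined by $\langle\mathcal L\phi,\psi\rangle_{L^2_\rho}=\mathbb E[\langle R_\phi[u],R_\psi[u]\rangle_{\mathbb Y}]$ (these expectations being finite) is nonnegative, self-adjoint and compact, with positive eigenvalues $\lambda_1\ge\lambda_2\ge\cdots>0$ (infinitely many, counted with multiplicity) decaying either polynomially ($ak^{-2r}\le\lambda_k\le bk^{-2r}$ for all $k$, $r>1/4$) or exponentially ($ae^{-rk}\le\lambda_k\le be^{-rk}$ for all $k$, $r>0$), with $b\ge a>0$. Let $\{\psi_k\}_{k\ge1}$ be corresponding orthonormal eigenfunctions. Fourth-moment condition. For a given $\beta\ge0$ there is $\kappa\ge1$ with $\mathbb E[\|R_\phi[u]\|_{\mathbb Y}^4]\le\kappa\,(\mathbb E[\|R_\phi[u]\|_{\mathbb Y}^2])^2$ for all $\phi\in H^\beta_\rho$, where $H^\beta_\rho=\{\phi=\sum_{k\ge1}\theta_k\psi_k:\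 \sum_{k\ge1}\lambda_k^{-\beta}\theta_k^2<\infty\}$. Empirical normal matrix. $\overline A_{n,M}\in\mathbb R^{n\times n}$ with $\overline A_{n,M}(k,l)=\frac1M\sum_{m=1}^M\langle R_{\psi_k}[u^m],R_{\psi_l}[u^m]\rangle_{\mathbb Y}$. *)

theory Defs
  imports "HOL-Probability.Probability" "Jordan_Normal_Form.Spectral_Radius"
begin

section \<open>The space of square-integrable functions\<close>

text \<open>
  Elements of \<open>L\<^sup>2(\<rho>)\<close> are handled through representatives: \<open>L2 \<rho>\<close> is the set of
  square-integrable functions, equality in \<open>L\<^sup>2(\<rho>)\<close> is equality almost everywhere, and a
  map defined on \<open>L\<^sup>2(\<rho>)\<close> is a map on representatives that respects it.
\<close>

definition L2 :: "'a measure \<Rightarrow> ('a \<Rightarrow> real) set" where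
  "L2 \<rho> = {f \<in> borel_measurable \<rho>. integrable \<rho> (\<lambda>x. (f x)\<^sup>2)}"

definition L2_inner :: "'a measure \<Rightarrow> ('a \<Rightarrow> real) \<Rightarrow> ('a \<Rightarrow> real) \<Rightarrow> real" where
  "L2_inner \<rho> f g = (\<integral>x. f x * g x \<partial>\<rho>)"

definition L2_norm :: "'a measure \<Rightarrow> ('a \<Rightarrow> real) \<Rightarrow> real" where
  "L2_norm \<rho> f = sqrt (L2_inner \<rho> f f)"

definition L2_operator :: "'a measure \<Rightarrow> (('a \<Rightarrow> real) \<Rightarrow> 'a \<Rightarrow> real) \<Rightarrow> bool" where
  "L2_operator \<rho> L \<longleftrightarrow>
     (\<forall>\<phi>\<in>L2 \<rho>. L \<phi> \<in> L2 \<rho>) \<and>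
     (\<forall>\<phi>\<in>L2 \<rho>. \<forall>\<psi>\<in>L2 \<rho>. (AE x in \<rho>. \<phi> x = \<psi> x) \<longrightarrow> (AE x in \<rho>. L \<phi> x = L \<psi> x)) \<and>
     (\<forall>\<phi>\<in>L2 \<rho>. \<forall>\<psi>\<in>L2 \<rho>. \<forall>a b.
        AE x in \<rho>. L (\<lambda>y. a * \<phi> y + b * \<psi> y) x = a * L \<phi> x + b * L \<psi> x)"

definition L2_nonnegative :: "'a measure \<Rightarrow> (('a \<Rightarrow> real) \<Rightarrow> 'a \<Rightarrow> real) \<Rightarrow> bool" where
  "L2_nonnegative \<rho> L \<longleftrightarrow> (\<forall>\<phi>\<in>L2 \<rho>. 0 \<le> L2_inner \<rho> (L \<phi>) \<phi>)"

definition L2_self_adjoint :: "'a measure \<Rightarrow> (('a \<Rightarrow> real) \<Rightarrow> 'a \<Rightarrow> real) \<Rightarrow> bool" where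
  "L2_self_adjoint \<rho> L \<longleftrightarrow>
     (\<forall>\<phi>\<in>L2 \<rho>. \<forall>\<psi>\<in>L2 \<rho>. L2_inner \<rho> (L \<phi>) \<psi> = L2_inner \<rho> \<phi> (L \<psi>))"

definition L2_compact :: "'a measure \<Rightarrow> (('a \<Rightarrow> real) \<Rightarrow> 'a \<Rightarrow> real) \<Rightarrow> bool" where
  "L2_compact \<rho> L \<longleftrightarrow>
     (\<forall>f :: nat \<Rightarrow> 'a \<Rightarrow> real. (\<forall>j. f j \<in> L2 \<rho>) \<and> (\<exists>B. \<forall>j. L2_norm \<rho> (f j) \<le> B) \<longrightarrow>
        (\<exists>g\<in>L2 \<rho>. \<exists>r :: nat \<Rightarrow> nat. strict_mono r \<and>
           (\<lambda>j. L2_norm \<rho> (\<lambda>x. L (f (r j)) x - g x)) \<longlonglongrightarrow> 0))"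


section \<open>Forward operator and normal operator\<close>

definition forward_operator ::
  "'a measure \<Rightarrow> (('a \<Rightarrow> real) \<Rightarrow> 'x::topological_space \<Rightarrow> 'y::real_inner) \<Rightarrow> bool" where
  "forward_operator \<rho> R \<longleftrightarrow>
     (\<forall>\<phi>\<in>L2 \<rho>. R \<phi> \<in> borel_measurable borel) \<and>
     (\<forall>\<phi>\<in>L2 \<rho>. \<forall>\<psi>\<in>L2 \<rho>. (AE x in \<rho>. \<phi> x = \<psi> x) \<longrightarrow> R \<phi> = R \<psi>) \<and>
     (\<forall>v. \<forall>\<phi>\<in>L2 \<rho>. \<forall>\<psi>\<in>L2 \<rho>. \<forall>a b.
        R (\<lambda>x. a * \<phi> x + b * \<psi> x) v = a *\<^sub>R R \<phi> v + b *\<^sub>R R \<psi> v)"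

definition normal_operator ::
  "'w measure \<Rightarrow> ('w \<Rightarrow> 'x) \<Rightarrow> 'a measure \<Rightarrow> (('a \<Rightarrow> real) \<Rightarrow> 'x \<Rightarrow> 'y::real_inner) \<Rightarrow>
   (('a \<Rightarrow> real) \<Rightarrow> 'a \<Rightarrow> real) \<Rightarrow> bool" where
  "normal_operator P u \<rho> R L \<longleftrightarrow>
     L2_operator \<rho> L \<and>
     (\<forall>\<phi>\<in>L2 \<rho>. \<forall>\<psi>\<in>L2 \<rho>.
        integrable P (\<lambda>\<omega>. inner (R \<phi> (u \<omega>)) (R \<psi> (u \<omega>))) \<and>
        L2_inner \<rho> (L \<phi>) \<psi> = (\<integral>\<omega>. inner (R \<phi> (u \<omega>)) (R \<psi> (u \<omega>)) \<partial>P))"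

text \<open>
  Sequences are indexed by \<open>k \<ge> 1\<close>; the values at \<open>0\<close> are irrelevant. The last conjunct says
  that every eigenvalue \<open>\<mu> > 0\<close> is listed with its full multiplicity: its eigenspace is
  spanned by the listed eigenfunctions with \<open>\<lambda>\<^sub>k = \<mu>\<close>.
\<close>

definition positive_eigensystem ::
  "'a measure \<Rightarrow> (('a \<Rightarrow> real) \<Rightarrow> 'a \<Rightarrow> real) \<Rightarrow> (nat \<Rightarrow> real) \<Rightarrow> (nat \<Rightarrow> 'a \<Rightarrow> real) \<Rightarrow> bool" where
  "positive_eigensystem \<rho> L lam \<psi> \<longleftrightarrow>
     (\<forall>k\<ge>1. 0 < lam k \<and> lam (Suc k) \<le> lam k) \<and>
     (\<forall>k\<ge>1. \<psi> k \<in> L2 \<rho> \<and> (AE x in \<rho>. L (\<psi> k) x = lam k * \<psi> k x)) \<and>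
     (\<forall>k\<ge>1. \<forall>l\<ge>1. L2_inner \<rho> (\<psi> k) (\<psi> l) = (if k = l then 1 else 0)) \<and>
     (\<forall>\<mu>>0. \<forall>\<phi>\<in>L2 \<rho>. (AE x in \<rho>. L \<phi> x = \<mu> * \<phi> x) \<longrightarrow>
        (\<exists>F c. finite F \<and> F \<subseteq> {k. 1 \<le> k \<and> lam k = \<mu>} \<and>
           (AE x in \<rho>. \<phi> x = (\<Sum>k\<in>F. c k * \<psi> k x))))"

definition polynomial_decay :: "(nat \<Rightarrow> real) \<Rightarrow> bool" where
  "polynomial_decay lam \<longleftrightarrow>
     (\<exists>a b r :: real. 0 < a \<and> a \<le> b \<and> r > 1/4 \<and>
        (\<forall>k\<ge>1. a * real k powr (- 2 * r) \<le> lam k \<and> lam k \<le> b * real k powr (- 2 * r)))"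

definition exponential_decay :: "(nat \<Rightarrow> real) \<Rightarrow> bool" where
  "exponential_decay lam \<longleftrightarrow>
     (\<exists>a b r :: real. 0 < a \<and> a \<le> b \<and> r > 0 \<and>
        (\<forall>k\<ge>1. a * exp (- r * real k) \<le> lam k \<and> lam k \<le> b * exp (- r * real k)))"


section \<open>Fourth-moment condition\<close>

definition H_space ::
  "'a measure \<Rightarrow> (nat \<Rightarrow> real) \<Rightarrow> (nat \<Rightarrow> 'a \<Rightarrow> real) \<Rightarrow> real \<Rightarrow> ('a \<Rightarrow> real) set" where
  "H_space \<rho> lam \<psi> \<beta> =
     {\<phi> \<in> L2 \<rho>. \<exists>\<theta> :: nat \<Rightarrow> real.
        (\<lambda>N. L2_norm \<rho> (\<lambda>x. \<phi> x - (\<Sum>k=1..N. \<theta> k * \<psi> k x))) \<longlonglongrightarrow> 0 \<and>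
        (\<lambda>k. lam k powr (- \<beta>) * (\<theta> k)\<^sup>2) summable_on {1..}}"

text \<open>
  Integrability is explicit because the integral of a non-integrable function is \<open>0\<close>, which
  would make the bound void exactly when the fourth moment is infinite.
\<close>

definition fourth_moment_condition ::
  "'w measure \<Rightarrow> ('w \<Rightarrow> 'x) \<Rightarrow> (('a \<Rightarrow> real) \<Rightarrow> 'x \<Rightarrow> 'y::real_inner) \<Rightarrow> ('a \<Rightarrow> real) set \<Rightarrow>
   real \<Rightarrow> bool" where
  "fourth_moment_condition P u R H \<kappa> \<longleftrightarrow>
     (\<forall>\<phi>\<in>H. integrable P (\<lambda>\<omega>. norm (R \<phi> (u \<omega>)) ^ 4) \<and>
        (\<integral>\<omega>. norm (R \<phi> (u \<omega>)) ^ 4 \<partial>P) \<le> \<kappa> * (\<integral>\<omega>. (norm (R \<phi> (u \<omega>)))\<^sup>2 \<partial>P)\<^sup>2)"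


section \<open>Empirical normal matrix\<close>

definition iid_copies ::
  "'w measure \<Rightarrow> ('w \<Rightarrow> 'x::topological_space) \<Rightarrow> (nat \<Rightarrow> 'w \<Rightarrow> 'x) \<Rightarrow> nat \<Rightarrow> bool" where
  "iid_copies P u U M \<longleftrightarrow>
     prob_space.indep_vars P (\<lambda>_. borel) U {1..M} \<and>
     (\<forall>m\<in>{1..M}. distr P borel (U m) = distr P borel u)"

text \<open>Matrix indices start at \<open>0\<close>, hence the shift by \<open>Suc\<close>.\<close>

definition empirical_normal_matrix ::
  "(('a \<Rightarrow> real) \<Rightarrow> 'x \<Rightarrow> 'y::real_inner) \<Rightarrow> (nat \<Rightarrow> 'a \<Rightarrow> real) \<Rightarrow> (nat \<Rightarrow> 'x) \<Rightarrow> nat \<Rightarrow> nat \<Rightarrow>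
   real Matrix.mat" where
  "empirical_normal_matrix R \<psi> v n M =
     Matrix.mat n n (\<lambda>(k, l).
       1 / real M * (\<Sum>m=1..M. inner (R (\<psi> (Suc k)) (v m)) (R (\<psi> (Suc l)) (v m))))"

text \<open>Meaningful for real symmetric matrices of positive dimension, whose spectrum is
  finite and nonempty.\<close>

definition lambda_min :: "real Matrix.mat \<Rightarrow> real" where
  "lambda_min A = Min (spectrum A)"

end

theory Submission
  imports Defs
begin

text \<open>
  Let \<open>v\<close> be a unit eigenvector for the smallest eigenvalue of the empirical matrix and let
  \<open>T = \<lambda>\<^sub>1 + 1\<close>. Instead of controlling the operator norm on a net of the sphere, round \<open>v\<close>
  coordinatewise to the lattice \<open>\<delta>\<int>\<^sup>n\<close> with \<open>\<delta>\<^sup>2 = \<lambda>\<^sub>n / (2 n T)\<close>: some rounding raises a quadratic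
  form by at most \<open>\<delta>\<^sup>2/4\<close> times its trace, so only the trace has to be bounded. It is less than
  \<open>n T\<close> outside an event of probability \<open>\<kappa> \<lambda>\<^sub>1\<^sup>2 / M\<close> by Chebyshev's inequality and the fourth-moment
  condition. Applied to the empirical form minus \<open>h = (4 - \<epsilon>)/8\<close> times its expectation, the rounding
  yields a nonzero lattice vector at which the empirical form is at most \<open>h\<close> times its mean. For a
  fixed vector this has probability at most \<open>exp (- M (1 - h)\<^sup>2 / (2 \<kappa>))\<close>, because only two moments are
  needed for the lower tail of a sum of nonnegative variables. The union bound runs over at most
  \<open>(20 T / \<lambda>\<^sub>n)\<^sup>n\<close> lattice vectors, and \<open>4 (1 - h)\<^sup>2 \<ge> \<epsilon>\<close> since \<open>(4 + \<epsilon>)\<^sup>2 \<ge> 16 \<epsilon>\<close>.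
\<close>

section \<open>Lattice points and rounding\<close>

lemma finite_PiE_abs_sum_le:
  fixes c :: real
  assumes "finite I"
  shows "finite {z \<in> I \<rightarrow>\<^sub>E (UNIV :: int set). (\<Sum>k\<in>I. \<bar>real_of_int (z k)\<bar>) \<le> c}"
proof (rule finite_subset)
  let ?K = "\<lceil>c\<rceil>"
  show "finite (I \<rightarrow>\<^sub>E {-?K..?K})"
    using assms by (intro finite_PiE) auto
  show "{z \<in> I \<rightarrow>\<^sub>E (UNIV :: int set). (\<Sum>k\<in>I. \<bar>real_of_int (z k)\<bar>) \<le> c} \<subseteq> I \<rightarrow>\<^sub>E {-?K..?K}"
  proof
    fix z assume "z \<in> {z \<in> I \<rightarrow>\<^sub>E (UNIV :: int set). (\<Sum>k\<in>I. \<bar>real_of_int (z k)\<bar>) \<le> c}"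
    then have z: "z \<in> I \<rightarrow>\<^sub>E (UNIV :: int set)" "(\<Sum>k\<in>I. \<bar>real_of_int (z k)\<bar>) \<le> c" by auto
    show "z \<in> I \<rightarrow>\<^sub>E {-?K..?K}"
    proof (rule PiE_I)
      fix k assume k: "k \<in> I"
      have "\<bar>real_of_int (z k)\<bar> \<le> c"
        using member_le_sum[OF k, of "\<lambda>k. \<bar>real_of_int (z k)\<bar>"] assms z(2) by force
      then have "real_of_int (z k) \<le> real_of_int ?K" "- real_of_int (z k) \<le> real_of_int ?K"
        using le_of_int_ceiling[of c] by linarith+
      then show "z k \<in> {-?K..?K}"
        unfolding atLeastAtMost_iff by linarith
    qed (use z in \<open>auto simp: PiE_iff extensional_def\<close>)
  qed
qed

text \<open>With \<open>x = exp (- 1 / r)\<close> the sum is a truncated two-sided geometric series,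
  at most \<open>1 + 2 * x / (1 - x)\<close>. The inequality \<open>exp (1 / r) >= 1 + 1 / r\<close>
  gives \<open>x / (1 - x) <= r\<close>.\<close>

lemma sum_exp_neg_abs_le:
  fixes r :: real
  assumes "r > 0"
  shows "(\<Sum>j\<in>{-int K..int K}. exp (- \<bar>real_of_int j\<bar> / r)) \<le> 2 * r + 1"
proof -
  define x where "x = exp (- 1 / r)"
  have x: "0 < x" "x < 1" using assms by (auto simp: x_def)
  have pow: "exp (- (real j / r)) = x ^ j" for j :: nat
    by (simp add: x_def exp_of_nat_mult[symmetric])
  have geo: "(\<Sum>j\<in>{1..K}. x ^ j) \<le> x / (1 - x)"
  proof -
    have "(\<Sum>j\<in>{1..K}. x ^ j) = (\<Sum>j<K. x * x ^ j)"
      by (rule sum.reindex_bij_witness[of _ Suc "\<lambda>j. j - 1"]) (auto simp: power_eq_if)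
    also have "\<dots> = x * ((1 - x ^ K) / (1 - x))"
      using x by (simp add: sum_distrib_left[symmetric] sum_gp_strict)
    also have "\<dots> = (x - x * x ^ K) / (1 - x)"
      by (simp add: right_diff_distrib)
    also have "\<dots> \<le> x / (1 - x)"
      using x by (simp add: divide_right_mono)
    finally show ?thesis .
  qed
  have "1 + 1 / r \<le> 1 / x"
    using exp_ge_add_one_self[of "1 / r"] by (simp add: x_def exp_minus inverse_eq_divide)
  then have "x / (1 - x) \<le> r"
    using x assms by (simp add: field_simps)
  have split: "{-int K..int K} = (\<lambda>j. - int j) ` {1..K} \<union> ({0} \<union> int ` {1..K})"
  proof
    show "{-int K..int K} \<subseteq> (\<lambda>j. - int j) ` {1..K} \<union> ({0} \<union> int ` {1..K})"
    proof
      fix j assume "j \<in> {-int K..int K}"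
      then have "j = - int (nat (- j)) \<and> nat (- j) \<in> {1..K} \<or> j = 0 \<or> j = int (nat j) \<and> nat j \<in> {1..K}"
        by auto
      then show "j \<in> (\<lambda>j. - int j) ` {1..K} \<union> ({0} \<union> int ` {1..K})" by blast
    qed
  qed auto
  have "(\<Sum>j\<in>{-int K..int K}. exp (- \<bar>real_of_int j\<bar> / r))
      = (\<Sum>j\<in>(\<lambda>j. - int j) ` {1..K}. exp (- \<bar>real_of_int j\<bar> / r))
        + (\<Sum>j\<in>{0} \<union> int ` {1..K}. exp (- \<bar>real_of_int j\<bar> / r))"
    unfolding split by (rule sum.union_disjoint) auto
  also have "(\<Sum>j\<in>{0} \<union> int ` {1..K}. exp (- \<bar>real_of_int j\<bar> / r))
      = 1 + (\<Sum>j\<in>int ` {1..K}. exp (- \<bar>real_of_int j\<bar> / r))"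
    by (subst sum.union_disjoint) auto
  also have "(\<Sum>j\<in>int ` {1..K}. exp (- \<bar>real_of_int j\<bar> / r)) = (\<Sum>j\<in>{1..K}. x ^ j)"
    by (subst sum.reindex) (auto simp: pow)
  also have "(\<Sum>j\<in>(\<lambda>j. - int j) ` {1..K}. exp (- \<bar>real_of_int j\<bar> / r)) = (\<Sum>j\<in>{1..K}. x ^ j)"
    by (subst sum.reindex) (auto simp: pow inj_on_def)
  also have "(\<Sum>j\<in>{1..K}. x ^ j) + (1 + (\<Sum>j\<in>{1..K}. x ^ j)) \<le> 2 * r + 1"
    using geo \<open>x / (1 - x) \<le> r\<close> by simp
  finally show ?thesis .
qed

text \<open>Counting by exponential weights: each admissible \<open>z\<close> has weight
  \<open>exp (n - (sum of the absolute values) / r) >= 1\<close>. Summed over the enclosing box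
  \<open>G\<close>, the weights factor into \<open>n\<close> one-dimensional sums, each at most
  \<open>2 * r + 1\<close>.\<close>

lemma card_PiE_abs_sum_le:
  fixes r :: real
  assumes "r > 0"
  shows "real (card {z \<in> {..<n} \<rightarrow>\<^sub>E (UNIV :: int set). (\<Sum>k<n. \<bar>real_of_int (z k)\<bar>) \<le> real n * r})
    \<le> (exp 1 * (2 * r + 1)) ^ n"
proof -
  define F where "F = {z \<in> {..<n} \<rightarrow>\<^sub>E (UNIV :: int set). (\<Sum>k<n. \<bar>real_of_int (z k)\<bar>) \<le> real n * r}"
  define K where "K = nat \<lceil>real n * r\<rceil>"
  define G where "G = {..<n} \<rightarrow>\<^sub>E {-int K..int K}"
  have "F \<subseteq> G"
  proof
    fix z assume "z \<in> F"
    then have z: "z \<in> {..<n} \<rightarrow>\<^sub>E (UNIV :: int set)" "(\<Sum>k<n. \<bar>real_of_int (z k)\<bar>) \<le> real n * r"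
      by (auto simp: F_def)
    have "z k \<in> {-int K..int K}" if k: "k < n" for k
    proof -
      have "\<bar>real_of_int (z k)\<bar> \<le> real n * r"
        using member_le_sum[of k "{..<n}" "\<lambda>k. \<bar>real_of_int (z k)\<bar>"] k z(2) by force
      then have "real_of_int \<bar>z k\<bar> \<le> real K" using assms by (simp add: K_def) linarith
      then have "\<bar>z k\<bar> \<le> int K" by linarith
      then show ?thesis by auto
    qed
    then show "z \<in> G" using z(1) by (auto simp: G_def PiE_iff)
  qed
  have "finite G" by (auto simp: G_def intro!: finite_PiE)
  have "real (card F) = (\<Sum>z\<in>F. 1)" by simp
  also have "\<dots> \<le> (\<Sum>z\<in>F. exp (real n) * (\<Prod>k<n. exp (- \<bar>real_of_int (z k)\<bar> / r)))"
  proof (rule sum_mono)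
    fix z assume "z \<in> F"
    then have "(\<Sum>k<n. \<bar>real_of_int (z k)\<bar>) / r \<le> real n"
      using assms by (simp add: F_def pos_divide_le_eq)
    then show "1 \<le> exp (real n) * (\<Prod>k<n. exp (- \<bar>real_of_int (z k)\<bar> / r))"
      by (simp add: exp_sum[symmetric] exp_add[symmetric] sum_negf sum_divide_distrib)
  qed
  also have "\<dots> \<le> (\<Sum>z\<in>G. exp (real n) * (\<Prod>k<n. exp (- \<bar>real_of_int (z k)\<bar> / r)))"
    using \<open>F \<subseteq> G\<close> \<open>finite G\<close> by (intro sum_mono2) (auto intro!: mult_nonneg_nonneg prod_nonneg)
  also have "\<dots> = exp (real n) * (\<Prod>k<n. \<Sum>j\<in>{-int K..int K}. exp (- \<bar>real_of_int j\<bar> / r))"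
    unfolding G_def sum_distrib_left[symmetric] by (subst prod_sum_PiE) auto
  also have "\<dots> \<le> exp (real n) * (\<Prod>k<n. 2 * r + 1)"
    using assms by (intro mult_left_mono prod_mono conjI sum_nonneg sum_exp_neg_abs_le) auto
  also have "\<dots> = (exp 1 * (2 * r + 1)) ^ n"
    by (simp add: power_mult_distrib exp_of_nat_mult[symmetric])
  finally show ?thesis by (simp add: F_def)
qed

text \<open>If \<open>x\<close> lies \<open>a\<close> above its lower neighbour in the lattice, the
  neighbours have offsets \<open>-a\<close> and \<open>\<delta> - a\<close>. Under the weights
  \<open>\<delta> - a\<close> and \<open>a\<close> the linear term cancels and the square averages
  to \<open>a * (\<delta> - a)\<close>, which is at most \<open>\<delta>\<^sup>2 / 4\<close>; one of
  the two values does not exceed the average. The nonnegative majorant \<open>d\<close> covers the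
  case of negative \<open>b\<close>.\<close>

lemma quadratic_rounding:
  fixes x \<delta> g b d :: real
  assumes \<delta>: "\<delta> > 0" and "b \<le> d" "0 \<le> d"
  shows "\<exists>j::int. \<bar>\<delta> * j - x\<bar> \<le> \<delta> \<and> g * (\<delta> * j - x) + b * (\<delta> * j - x)\<^sup>2 \<le> \<delta>\<^sup>2 / 4 * d"
proof -
  define j where "j = \<lfloor>x / \<delta>\<rfloor>"
  define a where "a = x - \<delta> * j"
  have "real_of_int j \<le> x / \<delta>" "x / \<delta> < real_of_int j + 1"
    by (simp_all add: j_def) 
  then have a: "0 \<le> a" "a < \<delta>" using \<delta> by (auto simp: a_def field_simps)
  define q where "q = (\<lambda>s. g * s + b * s\<^sup>2)"
  have avg: "(\<delta> - a) * q (- a) + a * q (\<delta> - a) = \<delta> * (a * (\<delta> - a) * b)"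
    by (simp add: q_def power2_eq_square algebra_simps)
  have "a * (\<delta> - a) \<le> \<delta>\<^sup>2 / 4"
  proof -
    have "\<delta>\<^sup>2 / 4 - a * (\<delta> - a) = (a - \<delta> / 2)\<^sup>2"
      by (simp add: power2_eq_square algebra_simps)
    then show ?thesis using zero_le_power2[of "a - \<delta> / 2"] by linarith
  qed
  then have *: "a * (\<delta> - a) * b \<le> \<delta>\<^sup>2 / 4 * d"
    using a assms mult_right_mono[of "a * (\<delta> - a)" "\<delta>\<^sup>2 / 4" d] mult_left_mono[of b d "a * (\<delta> - a)"]
    by (meson diff_ge_0_iff_ge less_imp_le mult_nonneg_nonneg order_trans)
  have "q (- a) \<le> \<delta>\<^sup>2 / 4 * d \<or> q (\<delta> - a) \<le> \<delta>\<^sup>2 / 4 * d"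
  proof (rule ccontr)
    assume H: "\<not> ?thesis"
    define c where "c = \<delta>\<^sup>2 / 4 * d"
    have "\<delta> * c = (\<delta> - a) * c + a * c" by (simp add: algebra_simps)
    also have "\<dots> < (\<delta> - a) * q (- a) + a * q (\<delta> - a)"
      using H a unfolding c_def by (intro add_less_le_mono mult_strict_left_mono mult_left_mono) auto
    also have "\<dots> \<le> \<delta> * c" unfolding avg using * \<delta> unfolding c_def by (intro mult_left_mono) auto
    finally show False by simp
  qed
  then show ?thesis
  proof
    assume "q (- a) \<le> \<delta>\<^sup>2 / 4 * d"
    then show ?thesis using a by (intro exI[of _ j]) (auto simp: q_def a_def)
  next
    assume "q (\<delta> - a) \<le> \<delta>\<^sup>2 / 4 * d"
    moreover have "\<delta> - a = \<delta> * of_int (j + 1) - x" by (simp add: a_def algebra_simps)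
    ultimately show ?thesis using a by (intro exI[of _ "j + 1"]) (simp add: q_def)
  qed
qed

text \<open>Derandomized random rounding: rounding each coordinate of \<open>v\<close> to one of its two
  neighbours in \<open>\<delta>\<int>\<close> with mean \<open>v\<^sub>k\<close> raises a quadratic form on average by at most
  \<open>\<delta>\<^sup>2/4\<close> times its trace, so some choice does not exceed this average.\<close>

lemma lattice_rounding:
  fixes Q :: "(nat \<Rightarrow> real) \<Rightarrow> real" and b d v :: "nat \<Rightarrow> real"
  assumes quad: "\<And>w k. k < n \<Longrightarrow> \<exists>g. \<forall>s. Q (w(k := w k + s)) = Q w + g * s + b k * s\<^sup>2"
    and \<delta>: "\<delta> > 0" and b: "\<And>k. k < n \<Longrightarrow> b k \<le> d k" and d: "\<And>k. k < n \<Longrightarrow> 0 \<le> d k"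
  shows "\<exists>z :: nat \<Rightarrow> int. (\<forall>k<n. \<bar>\<delta> * z k - v k\<bar> \<le> \<delta>) \<and>
    Q (\<lambda>k. if k < n then \<delta> * z k else v k) \<le> Q v + \<delta>\<^sup>2 / 4 * (\<Sum>k<n. d k)"
  using assms(1,3,4)
proof (induction n)
  case 0
  then show ?case by simp
next
  case (Suc n)
  obtain z :: "nat \<Rightarrow> int" where z: "\<forall>k<n. \<bar>\<delta> * z k - v k\<bar> \<le> \<delta>"
    "Q (\<lambda>k. if k < n then \<delta> * z k else v k) \<le> Q v + \<delta>\<^sup>2 / 4 * (\<Sum>k<n. d k)"
    using Suc.IH[OF Suc.prems] by auto
  \<comment> \<open>Coordinates below \<open>n\<close> are rounded already and the others still
    agree with \<open>v\<close>. Only coordinate \<open>n\<close> moves next, and its increase adds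
    to the bound.\<close>
  define w where "w = (\<lambda>k. if k < n then \<delta> * z k else v k)"
  obtain g where g: "\<And>s. Q (w(n := w n + s)) = Q w + g * s + b n * s\<^sup>2"
    using Suc.prems(1)[of n w] by blast
  obtain j :: int where j: "\<bar>\<delta> * j - v n\<bar> \<le> \<delta>"
    "g * (\<delta> * j - v n) + b n * (\<delta> * j - v n)\<^sup>2 \<le> \<delta>\<^sup>2 / 4 * d n"
    using quadratic_rounding[OF \<delta>, of "b n" "d n" "v n" g] Suc.prems(2,3) by auto
  have eq: "(\<lambda>k. if k < Suc n then \<delta> * (z(n := j)) k else v k) = w(n := w n + (\<delta> * j - v n))"
    by (auto simp: w_def fun_eq_iff less_Suc_eq)
  have "Q (\<lambda>k. if k < Suc n then \<delta> * (z(n := j)) k else v k) \<le> Q v + \<delta>\<^sup>2 / 4 * (\<Sum>k<Suc n. d k)"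
    unfolding eq g using z(2)[folded w_def] j(2) by (simp add: distrib_left)
  moreover have "\<forall>k<Suc n. \<bar>\<delta> * (z(n := j)) k - v k\<bar> \<le> \<delta>"
    using z(1) j(1) by (auto simp: less_Suc_eq)
  ultimately show ?case by blast
qed

section \<open>Tail bounds for sums of independent variables\<close>

text \<open>Multiply \<open>1 + x + x\<^sup>2 / 2 <= exp x\<close> by the nonnegative factor
  \<open>1 - x + x\<^sup>2 / 2\<close>: the product on the left is \<open>1 + x^4 / 4\<close>, hence
  at least 1.\<close>

lemma exp_minus_le_quadratic:
  fixes x :: real
  assumes "x \<ge> 0"
  shows "exp (- x) \<le> 1 - x + x\<^sup>2 / 2"
proof -
  have "1 + x + x\<^sup>2 / 2 \<le> exp x" using assms by (rule exp_lower_Taylor_quadratic)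
  moreover have "0 \<le> 1 - x + x\<^sup>2 / 2"
    using zero_le_power2[of "x - 1"] by (simp add: power2_diff)
  ultimately have "(1 - x + x\<^sup>2 / 2) * (1 + x + x\<^sup>2 / 2) \<le> (1 - x + x\<^sup>2 / 2) * exp x"
    by (rule mult_left_mono)
  moreover have "(1 - x + x\<^sup>2 / 2) * (1 + x + x\<^sup>2 / 2) = 1 + (x\<^sup>2)\<^sup>2 / 4"
    by (simp add: power2_eq_square field_simps)
  ultimately have "1 \<le> (1 - x + x\<^sup>2 / 2) * exp x"
    using zero_le_power2[of "x\<^sup>2"] by linarith
  then show ?thesis by (simp add: exp_minus field_simps)
qed

context prob_space
begin

text \<open>Bienayme's identity: after expanding the square, the mixed products of distinct centred
  variables have mean zero by independence, so only the variances remain.\<close>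

lemma
  fixes X :: "'i \<Rightarrow> 'a \<Rightarrow> real"
  assumes I: "finite I" and indep: "indep_vars (\<lambda>_. borel) X I"
    and int2: "\<And>i. i \<in> I \<Longrightarrow> integrable M (\<lambda>\<omega>. (X i \<omega>)\<^sup>2)"
  shows integrable_square_centered_sum:
      "integrable M (\<lambda>\<omega>. (\<Sum>i\<in>I. X i \<omega> - expectation (X i))\<^sup>2)" (is ?int)
    and expectation_square_centered_sum:
      "expectation (\<lambda>\<omega>. (\<Sum>i\<in>I. X i \<omega> - expectation (X i))\<^sup>2) = (\<Sum>i\<in>I. variance (X i))" (is ?eq)
proof -
  have meas: "X i \<in> borel_measurable M" if "i \<in> I" for i
    using indep that by (auto simp: indep_vars_def)
  have int1: "integrable M (X i)" if "i \<in> I" for i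
    using meas[OF that] int2[OF that] by (rule square_integrable_imp_integrable)
  define D where "D i \<omega> = X i \<omega> - expectation (X i)" for i \<omega>
  have D1: "integrable M (\<lambda>\<omega>. D i \<omega>)" "expectation (\<lambda>\<omega>. D i \<omega>) = 0" if "i \<in> I" for i
    using int1[OF that] unfolding D_def by (simp_all add: prob_space)
  have D2: "integrable M (\<lambda>\<omega>. D i \<omega> * D i \<omega>)" if "i \<in> I" for i
    using int1[OF that] int2[OF that]
    by (auto simp: D_def power2_eq_square[symmetric] power2_diff)
  have indepD: "indep_vars (\<lambda>_. borel) D I"
    unfolding D_def by (rule indep_vars_compose2[OF indep]) auto
  have off: "integrable M (\<lambda>\<omega>. D i \<omega> * D j \<omega>) \<and> expectation (\<lambda>\<omega>. D i \<omega> * D j \<omega>) = 0"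
    if "i \<in> I" "j \<in> I" "i \<noteq> j" for i j
  proof -
    have ij: "indep_vars (\<lambda>_. borel) D {i, j}"
      using that by (intro indep_vars_subset[OF indepD]) auto
    then show ?thesis
      using indep_vars_integrable[OF _ ij] indep_vars_lebesgue_integral[OF _ ij] D1 that by auto
  qed
  have expand: "(\<Sum>i\<in>I. X i \<omega> - expectation (X i))\<^sup>2 = (\<Sum>i\<in>I. \<Sum>j\<in>I. D i \<omega> * D j \<omega>)" for \<omega>
    by (simp add: D_def power2_eq_square sum_product)
  have int: "integrable M (\<lambda>\<omega>. D i \<omega> * D j \<omega>)" if "i \<in> I" "j \<in> I" for i j
    using D2 off that by (cases "i = j") auto
  show ?int unfolding expand by (intro Bochner_Integration.integrable_sum int)
  have "expectation (\<lambda>\<omega>. (\<Sum>i\<in>I. X i \<omega> - expectation (X i))\<^sup>2)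
      = (\<Sum>i\<in>I. \<Sum>j\<in>I. expectation (\<lambda>\<omega>. D i \<omega> * D j \<omega>))"
    unfolding expand by (simp add: Bochner_Integration.integral_sum Bochner_Integration.integrable_sum int)
  also have "\<dots> = (\<Sum>i\<in>I. \<Sum>j\<in>I. if j = i then variance (X i) else 0)"
    using off by (intro sum.cong refl) (auto simp: D_def power2_eq_square)
  finally show ?eq using I by simp
qed

text \<open>Markov's inequality for the squared centred sum. Each variance is bounded by the second
  moment, so \<open>v\<close> need only dominate the latter.\<close>

lemma Chebyshev_indep_sum_upper:
  fixes X :: "'i \<Rightarrow> 'a \<Rightarrow> real"
  assumes I: "finite I" and indep: "indep_vars (\<lambda>_. borel) X I"
    and int2: "\<And>i. i \<in> I \<Longrightarrow> integrable M (\<lambda>\<omega>. (X i \<omega>)\<^sup>2)"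
    and m: "\<And>i. i \<in> I \<Longrightarrow> expectation (X i) = m"
    and v: "\<And>i. i \<in> I \<Longrightarrow> expectation (\<lambda>\<omega>. (X i \<omega>)\<^sup>2) \<le> v"
    and "a > 0" "I \<noteq> {}"
  shows "prob {\<omega> \<in> space M. (\<Sum>i\<in>I. X i \<omega>) \<ge> real (card I) * (m + a)} \<le> v / (real (card I) * a\<^sup>2)"
proof -
  have meas: "X i \<in> borel_measurable M" if "i \<in> I" for i
    using indep that by (auto simp: indep_vars_def)
  have int1: "integrable M (X i)" if "i \<in> I" for i
    using meas[OF that] int2[OF that] by (rule square_integrable_imp_integrable)
  have N: "real (card I) > 0" using assms by (simp add: card_gt_0_iff)
  let ?Y = "\<lambda>\<omega>. (\<Sum>i\<in>I. X i \<omega> - expectation (X i))\<^sup>2"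
  have Y: "?Y \<omega> = ((\<Sum>i\<in>I. X i \<omega>) - real (card I) * m)\<^sup>2" for \<omega>
    using m by (simp add: sum_subtractf)
  have intY: "integrable M ?Y"
    using I indep int2 by (rule integrable_square_centered_sum)
  have expY: "expectation ?Y = (\<Sum>i\<in>I. variance (X i))"
    using I indep int2 by (rule expectation_square_centered_sum)
  have "prob {\<omega> \<in> space M. (\<Sum>i\<in>I. X i \<omega>) \<ge> real (card I) * (m + a)}
      \<le> prob {\<omega> \<in> space M. ?Y \<omega> \<ge> (real (card I) * a)\<^sup>2}"
  proof (rule finite_measure_mono)
    show "{\<omega> \<in> space M. (\<Sum>i\<in>I. X i \<omega>) \<ge> real (card I) * (m + a)}
        \<subseteq> {\<omega> \<in> space M. ?Y \<omega> \<ge> (real (card I) * a)\<^sup>2}"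
      unfolding Y using N \<open>a > 0\<close> by (auto simp: distrib_left intro!: power_mono)
    show "{\<omega> \<in> space M. ?Y \<omega> \<ge> (real (card I) * a)\<^sup>2} \<in> sets M"
      using borel_measurable_integrable[OF intY] by measurable
  qed
  also have "\<dots> \<le> expectation ?Y / (real (card I) * a)\<^sup>2"
    using N \<open>a > 0\<close> by (intro integral_Markov_inequality_measure[OF intY, where A = "{}"]) auto
  also have "\<dots> \<le> (\<Sum>i\<in>I. v) / (real (card I) * a)\<^sup>2"
    unfolding expY
  proof (intro divide_right_mono sum_mono)
    fix i assume "i \<in> I"
    then have "variance (X i) = expectation (\<lambda>\<omega>. (X i \<omega>)\<^sup>2) - m\<^sup>2"
      using variance_eq[of "X i"] int1 int2 m by auto
    then show "variance (X i) \<le> v" using v[OF \<open>i \<in> I\<close>] zero_le_power2[of m] by linarith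
  qed simp
  also have "\<dots> = v / (real (card I) * a\<^sup>2)"
    using N by (simp add: power2_eq_square)
  finally show ?thesis .
qed

text \<open>Chernoff's method with negative exponent. Nonnegativity of \<open>Z\<close> makes the
  quadratic upper bound for \<open>exp (- x)\<close> available, so the Laplace transform is
  controlled by the first two moments.\<close>

lemma lower_tail_indep_sum_nonneg:
  fixes Z :: "'i \<Rightarrow> 'a \<Rightarrow> real"
  assumes I: "finite I" and indep: "indep_vars (\<lambda>_. borel) Z I"
    and nonneg: "\<And>i \<omega>. i \<in> I \<Longrightarrow> 0 \<le> Z i \<omega>"
    and int2: "\<And>i. i \<in> I \<Longrightarrow> integrable M (\<lambda>\<omega>. (Z i \<omega>)\<^sup>2)"
    and m: "\<And>i. i \<in> I \<Longrightarrow> expectation (Z i) = m"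
    and v: "\<And>i. i \<in> I \<Longrightarrow> expectation (\<lambda>\<omega>. (Z i \<omega>)\<^sup>2) \<le> \<kappa> * m\<^sup>2"
    and "m > 0" "\<kappa> > 0" "h \<le> 1"
  shows "prob {\<omega> \<in> space M. (\<Sum>i\<in>I. Z i \<omega>) \<le> real (card I) * (h * m)}
    \<le> exp (- (real (card I) * (1 - h)\<^sup>2 / (2 * \<kappa>)))"
proof -
  \<comment> \<open>This \<open>t\<close> minimises the exponent
    \<open>- t * (1 - h) * m + t\<^sup>2 * \<kappa> * m\<^sup>2 / 2\<close> obtained for each
    summand.\<close>
  define t where "t = (1 - h) / (\<kappa> * m)"
  have t: "t \<ge> 0" using assms by (simp add: t_def)
  define E where "E i \<omega> = exp (- (t * Z i \<omega>))" for i \<omega>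
  have meas [measurable]: "Z i \<in> borel_measurable M" if "i \<in> I" for i
    using indep that by (auto simp: indep_vars_def)
  have int1: "integrable M (Z i)" if "i \<in> I" for i
    using meas[OF that] int2[OF that] by (rule square_integrable_imp_integrable)
  have intE: "integrable M (E i)" if "i \<in> I" for i
    using t nonneg[OF that] that unfolding E_def
    by (intro integrable_const_bound[of _ 1]) auto
  have indepE: "indep_vars (\<lambda>_. borel) E I"
    unfolding E_def by (rule indep_vars_compose2[OF indep]) auto
  have mgf: "expectation (E i) \<le> exp (- (t * m) + t\<^sup>2 * \<kappa> * m\<^sup>2 / 2)" if i: "i \<in> I" for i
  proof -
    have "expectation (E i) \<le> expectation (\<lambda>\<omega>. 1 - t * Z i \<omega> + t\<^sup>2 / 2 * (Z i \<omega>)\<^sup>2)"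
    proof (rule integral_mono[OF intE[OF i]])
      show "integrable M (\<lambda>\<omega>. 1 - t * Z i \<omega> + t\<^sup>2 / 2 * (Z i \<omega>)\<^sup>2)"
        using int1[OF i] int2[OF i] by auto
      fix \<omega>
      show "E i \<omega> \<le> 1 - t * Z i \<omega> + t\<^sup>2 / 2 * (Z i \<omega>)\<^sup>2"
        using exp_minus_le_quadratic[of "t * Z i \<omega>"]
          t nonneg[OF i] by (simp add: E_def power_mult_distrib)
    qed
    also have "\<dots> = 1 - t * m + t\<^sup>2 / 2 * expectation (\<lambda>\<omega>. (Z i \<omega>)\<^sup>2)"
      using int1[OF i] int2[OF i] m[OF i] by (simp add: prob_space)
    also have "\<dots> \<le> 1 + (- (t * m) + t\<^sup>2 * \<kappa> * m\<^sup>2 / 2)"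
      using mult_left_mono[OF v[OF i], of "t\<^sup>2 / 2"] by simp
    also have "\<dots> \<le> exp (- (t * m) + t\<^sup>2 * \<kappa> * m\<^sup>2 / 2)" by (rule exp_ge_add_one_self)
    finally show ?thesis .
  qed
  define c where "c = exp (- (t * (real (card I) * (h * m))))"
  have prodE: "(\<Prod>i\<in>I. E i \<omega>) = exp (- (t * (\<Sum>i\<in>I. Z i \<omega>)))" for \<omega>
    using I by (simp add: E_def exp_sum sum_distrib_left sum_negf[symmetric])
  have intP: "integrable M (\<lambda>\<omega>. \<Prod>i\<in>I. E i \<omega>)"
    using I indepE intE by (rule indep_vars_integrable)
  have "prob {\<omega> \<in> space M. (\<Sum>i\<in>I. Z i \<omega>) \<le> real (card I) * (h * m)}
      \<le> prob {\<omega> \<in> space M. (\<Prod>i\<in>I. E i \<omega>) \<ge> c}"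
  proof (rule finite_measure_mono)
    show "{\<omega> \<in> space M. (\<Sum>i\<in>I. Z i \<omega>) \<le> real (card I) * (h * m)}
        \<subseteq> {\<omega> \<in> space M. (\<Prod>i\<in>I. E i \<omega>) \<ge> c}"
      unfolding prodE c_def using t by (auto intro!: mult_left_mono)
    show "{\<omega> \<in> space M. (\<Prod>i\<in>I. E i \<omega>) \<ge> c} \<in> sets M"
      using borel_measurable_integrable[OF intP] by measurable
  qed
  also have "\<dots> \<le> expectation (\<lambda>\<omega>. \<Prod>i\<in>I. E i \<omega>) / c"
    by (intro integral_Markov_inequality_measure[OF intP, where A = "{}"])
      (auto simp: c_def E_def intro!: prod_nonneg)
  also have "expectation (\<lambda>\<omega>. \<Prod>i\<in>I. E i \<omega>) = (\<Prod>i\<in>I. expectation (E i))"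
    using I indepE intE by (rule indep_vars_lebesgue_integral)
  also have "(\<Prod>i\<in>I. expectation (E i)) \<le> (\<Prod>i\<in>I. exp (- (t * m) + t\<^sup>2 * \<kappa> * m\<^sup>2 / 2))"
    by (intro prod_mono conjI mgf) (auto simp: E_def)
  also have "\<dots> = exp (real (card I) * (- (t * m) + t\<^sup>2 * \<kappa> * m\<^sup>2 / 2))"
    by (simp add: exp_of_nat_mult[symmetric])
  also have "\<dots> / c = exp (real (card I) * (- (t * m) + t\<^sup>2 * \<kappa> * m\<^sup>2 / 2 + t * (h * m)))"
    by (simp add: c_def exp_diff[symmetric] algebra_simps)
  also have "- (t * m) + t\<^sup>2 * \<kappa> * m\<^sup>2 / 2 + t * (h * m) = - ((1 - h)\<^sup>2 / (2 * \<kappa>))"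
    using \<open>m > 0\<close> \<open>\<kappa> > 0\<close> by (simp add: t_def power2_eq_square field_simps)
  finally show ?thesis by (simp add: c_def divide_right_mono)
qed

end

section \<open>The smallest eigenvalue of an empirical Gram matrix\<close>

text \<open>For a complex eigenvector \<open>w\<close>, the Hermitian form \<open>s\<close> equals
  \<open>e\<close> times the squared length of \<open>w\<close>. By symmetry \<open>s\<close> is its
  own conjugate, so \<open>e\<close> is a quotient of reals.\<close>

lemma eigenvalue_real_if_symmetric:
  fixes A :: "real Matrix.mat"
  assumes A: "A \<in> carrier_mat n n"
    and sym: "\<And>i j. i < n \<Longrightarrow> j < n \<Longrightarrow> A $$ (i, j) = A $$ (j, i)"
    and e: "eigenvalue (map_mat complex_of_real A) e"
  shows "e \<in> \<real>"
proof -
  obtain w where w: "w \<in> carrier_vec n" "w \<noteq> 0\<^sub>v n" "map_mat complex_of_real A *\<^sub>v w = e \<cdot>\<^sub>v w"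
    using e A by (auto simp: eigenvalue_def eigenvector_def)
  have comp: "(\<Sum>j<n. of_real (A $$ (i, j)) * w $ j) = e * w $ i" if "i < n" for i
  proof -
    have "(map_mat complex_of_real A *\<^sub>v w) $ i = (e \<cdot>\<^sub>v w) $ i" by (simp add: w(3))
    then show ?thesis
      using A w(1) that by (simp add: scalar_prod_def lessThan_atLeast0)
  qed
  define s where "s = (\<Sum>i<n. \<Sum>j<n. cnj (w $ i) * of_real (A $$ (i, j)) * w $ j)"
  define N where "N = (\<Sum>i<n. (cmod (w $ i))\<^sup>2)"
  have "s = (\<Sum>i<n. cnj (w $ i) * (e * w $ i))"
    by (simp add: s_def comp[symmetric] sum_distrib_left mult.assoc)
  also have "\<dots> = e * of_real N"
    unfolding N_def of_real_sum sum_distrib_left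
    by (intro sum.cong refl) (simp add: complex_norm_square[symmetric] mult_ac)
  finally have s: "s = e * of_real N" .
  have "cnj s = (\<Sum>i<n. \<Sum>j<n. cnj (w $ j) * of_real (A $$ (j, i)) * w $ i)"
    unfolding s_def cnj_sum by (intro sum.cong refl) (simp add: sym mult_ac)
  also have "\<dots> = s" unfolding s_def by (rule sum.swap)
  finally have "s \<in> \<real>" by (simp add: Reals_cnj_iff)
  obtain k where "k < n" "w $ k \<noteq> 0" using w(1,2) by (auto simp: vec_eq_iff)
  then have "N > 0" unfolding N_def by (intro sum_pos2[of _ k]) auto
  then have "e = s / of_real N" using s by simp
  then show ?thesis using \<open>s \<in> \<real>\<close> by simp
qed

text \<open>An eigenvalue exists over the complex numbers and is real by symmetry; being a root of
  the common characteristic polynomial, it is an eigenvalue of the real matrix too.\<close>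

lemma spectrum_nonempty_if_symmetric:
  fixes A :: "real Matrix.mat"
  assumes A: "A \<in> carrier_mat n n" and "n > 0"
    and sym: "\<And>i j. i < n \<Longrightarrow> j < n \<Longrightarrow> A $$ (i, j) = A $$ (j, i)"
  shows "spectrum A \<noteq> {}"
proof -
  let ?C = "map_mat complex_of_real A"
  have C: "?C \<in> carrier_mat n n" using A by simp
  obtain e where e: "eigenvalue ?C e"
    using spectrum_non_empty[OF C \<open>n > 0\<close>] by (auto simp: spectrum_def)
  obtain r where r: "e = of_real r"
    using eigenvalue_real_if_symmetric[OF A sym e] by (auto elim: Reals_cases)
  have "poly (map_poly complex_of_real (char_poly A)) (of_real r) = 0"
    using e eigenvalue_root_char_poly[OF C] by (simp add: r of_real_hom.char_poly_hom[OF A])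
  then have "poly (char_poly A) r = 0" by simp
  then show ?thesis
    using eigenvalue_root_char_poly[OF A] by (auto simp: spectrum_def)
qed

text \<open>Finiteness and nonemptiness of the spectrum make \<open>Min\<close> an actual
  eigenvalue; normalising an eigenvector for it gives \<open>v\<close>.\<close>

lemma lambda_min_attained:
  fixes A :: "real Matrix.mat"
  assumes A: "A \<in> carrier_mat n n" and n: "n > 0"
    and sym: "\<And>i j. i < n \<Longrightarrow> j < n \<Longrightarrow> A $$ (i, j) = A $$ (j, i)"
  obtains v :: "nat \<Rightarrow> real" where "(\<Sum>i<n. (v i)\<^sup>2) = 1"
    "(\<Sum>i<n. \<Sum>j<n. v i * A $$ (i, j) * v j) = lambda_min A"
proof -
  have "lambda_min A \<in> spectrum A"
    unfolding lambda_min_def using card_finite_spectrum[OF A] spectrum_nonempty_if_symmetric[OF A n sym]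
    by (intro Min_in) auto
  then obtain w where w: "w \<in> carrier_vec n" "w \<noteq> 0\<^sub>v n" "A *\<^sub>v w = lambda_min A \<cdot>\<^sub>v w"
    using A by (auto simp: spectrum_def eigenvalue_def eigenvector_def)
  have comp: "(\<Sum>j<n. A $$ (i, j) * w $ j) = lambda_min A * w $ i" if "i < n" for i
  proof -
    have "(A *\<^sub>v w) $ i = (lambda_min A \<cdot>\<^sub>v w) $ i" by (simp add: w(3))
    then show ?thesis
      using A w(1) that by (simp add: scalar_prod_def lessThan_atLeast0)
  qed
  define N where "N = (\<Sum>i<n. (w $ i)\<^sup>2)"
  obtain k where "k < n" "w $ k \<noteq> 0" using w(1,2) by (auto simp: vec_eq_iff)
  then have "N > 0" unfolding N_def by (intro sum_pos2[of _ k]) auto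
  define v where "v i = w $ i / sqrt N" for i
  show thesis
  proof
    show "(\<Sum>i<n. (v i)\<^sup>2) = 1"
      using \<open>N > 0\<close> by (simp add: v_def power_divide sum_divide_distrib[symmetric] N_def[symmetric])
    have "(\<Sum>i<n. \<Sum>j<n. v i * A $$ (i, j) * v j) = (\<Sum>i<n. w $ i * (\<Sum>j<n. A $$ (i, j) * w $ j)) / N"
      using \<open>N > 0\<close>
      by (simp add: v_def sum_distrib_left sum_divide_distrib field_simps real_sqrt_mult[symmetric])
    also have "(\<Sum>i<n. w $ i * (\<Sum>j<n. A $$ (i, j) * w $ j)) = lambda_min A * N"
      unfolding N_def sum_distrib_left[of "lambda_min A"]
      by (intro sum.cong refl) (simp add: comp power2_eq_square)
    finally show "(\<Sum>i<n. \<Sum>j<n. v i * A $$ (i, j) * v j) = lambda_min A"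
      using \<open>N > 0\<close> by simp
  qed
qed

text \<open>Here \<open>Y m k\<close> is the image of the \<open>m\<close>-th sample under the
  \<open>k\<close>-th feature map, so matrix arguments are free of the operator \<open>R\<close>.
  Samples count from 1, features from 0.\<close>

definition empirical_gram ::
  "(nat \<Rightarrow> nat \<Rightarrow> 'y::real_inner) \<Rightarrow> nat \<Rightarrow> nat \<Rightarrow> real Matrix.mat" where
  "empirical_gram Y n M =
     Matrix.mat n n (\<lambda>(k, l). 1 / real M * (\<Sum>m=1..M. inner (Y m k) (Y m l)))"

lemma empirical_gram_quadratic_form:
  "(\<Sum>i<n. \<Sum>j<n. v i * empirical_gram Y n M $$ (i, j) * v j)
    = 1 / real M * (\<Sum>m=1..M. (norm (\<Sum>k<n. v k *\<^sub>R Y m k))\<^sup>2)"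
proof -
  have "(\<Sum>i<n. \<Sum>j<n. v i * empirical_gram Y n M $$ (i, j) * v j)
      = 1 / real M * (\<Sum>i<n. \<Sum>j<n. \<Sum>m=1..M. v i * v j * inner (Y m i) (Y m j))"
    by (simp add: empirical_gram_def sum_distrib_left sum_divide_distrib mult_ac)
  also have "(\<Sum>i<n. \<Sum>j<n. \<Sum>m=1..M. v i * v j * inner (Y m i) (Y m j))
      = (\<Sum>i<n. \<Sum>m=1..M. \<Sum>j<n. v i * v j * inner (Y m i) (Y m j))"
    by (intro sum.cong refl sum.swap)
  also have "\<dots> = (\<Sum>m=1..M. \<Sum>i<n. \<Sum>j<n. v i * v j * inner (Y m i) (Y m j))"
    by (rule sum.swap)
  also have "\<dots> = (\<Sum>m=1..M. (norm (\<Sum>k<n. v k *\<^sub>R Y m k))\<^sup>2)"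
    unfolding power2_norm_eq_inner inner_sum_left inner_scaleR_left
    by (simp add: inner_sum_right sum_distrib_left mult.assoc)
  finally show ?thesis .
qed

lemma lambda_min_empirical_gram_attained:
  fixes Y :: "nat \<Rightarrow> nat \<Rightarrow> 'y::real_inner"
  assumes "n > 0"
  obtains v :: "nat \<Rightarrow> real" where "(\<Sum>i<n. (v i)\<^sup>2) = 1"
    "1 / real M * (\<Sum>m=1..M. (norm (\<Sum>k<n. v k *\<^sub>R Y m k))\<^sup>2) = lambda_min (empirical_gram Y n M)"
proof -
  have carrier: "empirical_gram Y n M \<in> carrier_mat n n" by (simp add: empirical_gram_def)
  have sym: "empirical_gram Y n M $$ (i, j) = empirical_gram Y n M $$ (j, i)" if "i < n" "j < n" for i j
    using that by (simp add: empirical_gram_def inner_commute)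
  obtain v :: "nat \<Rightarrow> real" where "(\<Sum>i<n. (v i)\<^sup>2) = 1"
    "(\<Sum>i<n. \<Sum>j<n. v i * empirical_gram Y n M $$ (i, j) * v j) = lambda_min (empirical_gram Y n M)"
    using lambda_min_attained[OF carrier assms sym] by blast
  then show thesis unfolding empirical_gram_quadratic_form by (rule that)
qed

text \<open>A unit vector on which the quadratic form is too small is traded for a lattice vector:
  the gap \<open>l/8\<close> absorbs the rounding error \<open>\<delta>\<^sup>2/4 \<cdot> n T = l/8\<close>, which is governed by the trace.\<close>

lemma lattice_witness_small_eigenvalue:
  fixes Y :: "nat \<Rightarrow> nat \<Rightarrow> 'y::real_inner" and a :: "nat \<Rightarrow> real" and l h T \<delta> :: real
  assumes \<delta>_def: "\<delta> = sqrt (l / (2 * real n * T))"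
    and n: "n > 0" and l: "l > 0" and la: "\<And>k. k < n \<Longrightarrow> l \<le> a k" and T: "T > 0" and h: "h \<ge> 0"
    and tr: "1 / real M * (\<Sum>m=1..M. \<Sum>k<n. (norm (Y m k))\<^sup>2) < real n * T"
    and small: "lambda_min (empirical_gram Y n M) \<le> (h - 1 / 8) * l"
  shows "\<exists>z \<in> {..<n} \<rightarrow>\<^sub>E (UNIV :: int set).
    (\<Sum>k<n. \<bar>real_of_int (z k)\<bar>) \<le> real n * (1 + sqrt (2 * (T / l))) \<and> (\<exists>k<n. z k \<noteq> 0) \<and>
    1 / real M * (\<Sum>m=1..M. (norm (\<Sum>k<n. (\<delta> * z k) *\<^sub>R Y m k))\<^sup>2) \<le> h * (\<Sum>k<n. a k * (\<delta> * z k)\<^sup>2)"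
proof -
  obtain v :: "nat \<Rightarrow> real" where v1: "(\<Sum>i<n. (v i)\<^sup>2) = 1" and
    "1 / real M * (\<Sum>m=1..M. (norm (\<Sum>k<n. v k *\<^sub>R Y m k))\<^sup>2) = lambda_min (empirical_gram Y n M)"
    using n by (rule lambda_min_empirical_gram_attained)
  then have v2: "1 / real M * (\<Sum>m=1..M. (norm (\<Sum>k<n. v k *\<^sub>R Y m k))\<^sup>2) \<le> (h - 1 / 8) * l"
    using small by simp
  \<comment> \<open>The empirical form minus \<open>h\<close> times its mean. Its diagonal
    coefficients are \<open>b k\<close>, which are dominated by the diagonal entries
    \<open>d k\<close> of the Gram matrix.\<close>
  define Q where "Q w = 1 / real M * (\<Sum>m=1..M. (norm (\<Sum>k<n. w k *\<^sub>R Y m k))\<^sup>2)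
    - h * (\<Sum>k<n. a k * (w k)\<^sup>2)" for w
  define d where "d k = 1 / real M * (\<Sum>m=1..M. (norm (Y m k))\<^sup>2)" for k
  define b where "b k = d k - h * a k" for k
  have \<delta>: "\<delta> > 0" "\<delta>\<^sup>2 = l / (2 * real n * T)" using n l T by (auto simp: \<delta>_def)
  have quad: "\<exists>g. \<forall>s. Q (w(k := w k + s)) = Q w + g * s + b k * s\<^sup>2" if k: "k < n" for w k
  proof (intro exI allI)
    fix s
    let ?S = "\<lambda>m. \<Sum>k<n. w k *\<^sub>R Y m k"
    have upd: "(\<Sum>i<n. f i ((w(k := w k + s)) i)) = (\<Sum>i<n. f i (w i)) + (f k (w k + s) - f k (w k))"
      for f :: "nat \<Rightarrow> real \<Rightarrow> 'z::ab_group_add"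
      using k by (simp add: sum.remove[of "{..<n}" k])
    have 1: "(norm (\<Sum>i<n. (w(k := w k + s)) i *\<^sub>R Y m i))\<^sup>2
        = (norm (?S m))\<^sup>2 + (2 * inner (?S m) (Y m k)) * s + (norm (Y m k))\<^sup>2 * s\<^sup>2" for m
    proof -
      have "(\<Sum>i<n. (w(k := w k + s)) i *\<^sub>R Y m i) = ?S m + s *\<^sub>R Y m k"
        by (subst upd[of "\<lambda>i x. x *\<^sub>R Y m i"]) (simp add: scaleR_left_distrib)
      moreover have "(norm (x + s *\<^sub>R y))\<^sup>2 = (norm x)\<^sup>2 + (2 * inner x y) * s + (norm y)\<^sup>2 * s\<^sup>2" for x y :: 'y
        unfolding power2_norm_eq_inner
        by (simp add: inner_add_left inner_add_right inner_commute power2_eq_square[of s] algebra_simps)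
      ultimately show ?thesis by (simp only:)
    qed
    have 2: "(\<Sum>i<n. a i * ((w(k := w k + s)) i)\<^sup>2) = (\<Sum>i<n. a i * (w i)\<^sup>2) + 2 * a k * w k * s + a k * s\<^sup>2"
      by (subst upd[of "\<lambda>i x. a i * x\<^sup>2"]) (simp add: power2_eq_square algebra_simps)
    show "Q (w(k := w k + s)) = Q w +
        (1 / real M * (\<Sum>m=1..M. 2 * inner (?S m) (Y m k)) - h * (2 * a k * w k)) * s + b k * s\<^sup>2"
      unfolding Q_def 1 2 b_def d_def sum.distrib sum_distrib_right[symmetric]
      by (simp add: algebra_simps)
  qed
  have d0: "d k \<ge> 0" for k by (simp add: d_def sum_nonneg)
  have bd: "b k \<le> d k" if "k < n" for k using h l la[OF that] by (simp add: b_def)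
  obtain z :: "nat \<Rightarrow> int" where z: "\<forall>k<n. \<bar>\<delta> * z k - v k\<bar> \<le> \<delta>"
    "Q (\<lambda>k. if k < n then \<delta> * z k else v k) \<le> Q v + \<delta>\<^sup>2 / 4 * (\<Sum>k<n. d k)"
    using lattice_rounding[of n Q b \<delta> d v] quad \<delta>(1) bd d0 by blast
  have "(\<Sum>k<n. d k) < real n * T"
    using tr unfolding d_def sum_distrib_left[symmetric] by (subst sum.swap)
  then have "\<delta>\<^sup>2 / 4 * (\<Sum>k<n. d k) < \<delta>\<^sup>2 / 4 * (real n * T)"
    using \<delta>(1) by (intro mult_strict_left_mono) auto
  also have "\<dots> = l / 8" using n T by (simp add: \<delta>(2))
  finally have round: "\<delta>\<^sup>2 / 4 * (\<Sum>k<n. d k) < l / 8" .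
  \<comment> \<open>At the unit vector \<open>v\<close> the mean form is at least \<open>l\<close>,
    so \<open>Q v <= (h - 1 / 8) * l - h * l\<close>, a margin of \<open>l / 8\<close> that strictly
    exceeds the rounding error.\<close>
  have "l * (\<Sum>k<n. (v k)\<^sup>2) \<le> (\<Sum>k<n. a k * (v k)\<^sup>2)"
    unfolding sum_distrib_left using la by (intro sum_mono mult_right_mono) auto
  then have "h * l \<le> h * (\<Sum>k<n. a k * (v k)\<^sup>2)" using h v1 by (simp add: mult_left_mono)
  then have "Q v \<le> - (l / 8)" using v2 by (simp add: Q_def algebra_simps)
  then have neg: "Q (\<lambda>k. if k < n then \<delta> * z k else v k) < 0" using z(2) round by linarith
  define z' where "z' = restrict z {..<n}"
  have Qz: "Q (\<lambda>k. if k < n then \<delta> * z k else v k) = Q (\<lambda>k. \<delta> * z' k)"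
    by (simp add: Q_def z'_def)
  have "z' \<in> {..<n} \<rightarrow>\<^sub>E (UNIV :: int set)" by (simp add: z'_def)
  \<comment> \<open>\<open>Q\<close> vanishes at the origin but is negative at the rounded
    vector.\<close>
  moreover have "\<exists>k<n. z' k \<noteq> 0"
  proof (rule ccontr)
    assume "\<not> (\<exists>k<n. z' k \<noteq> 0)"
    then have "Q (\<lambda>k. \<delta> * z' k) = 0" by (simp add: Q_def)
    then show False using neg Qz by simp
  qed
  moreover have "1 / real M * (\<Sum>m=1..M. (norm (\<Sum>k<n. (\<delta> * z' k) *\<^sub>R Y m k))\<^sup>2)
      \<le> h * (\<Sum>k<n. a k * (\<delta> * z' k)\<^sup>2)"
    using neg Qz by (simp add: Q_def)
  moreover have "(\<Sum>k<n. \<bar>real_of_int (z' k)\<bar>) \<le> real n * (1 + sqrt (2 * (T / l)))"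
  proof -
    \<comment> \<open>By Cauchy-Schwarz a unit vector has 1-norm at most \<open>sqrt n\<close>.
      Division by \<open>\<delta>\<close> turns this into \<open>n * sqrt (2 * (T / l))\<close>;
      rounding adds at most 1 per coordinate.\<close>
    have "(\<Sum>k<n. \<bar>v k\<bar>)\<^sup>2 \<le> real n"
      using Cauchy_Schwarz_ineq_sum[of "\<lambda>k. \<bar>v k\<bar>" "\<lambda>_. 1" "{..<n}"] v1 by simp
    then have v_abs: "(\<Sum>k<n. \<bar>v k\<bar>) \<le> sqrt (real n)" by (rule real_le_rsqrt)
    have "\<bar>real_of_int (z' k)\<bar> \<le> 1 + \<bar>v k\<bar> / \<delta>" if "k < n" for k
    proof -
      have "\<bar>\<delta> * z k\<bar> \<le> \<delta> + \<bar>v k\<bar>" using z(1) that by (smt (verit))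
      then show ?thesis using \<delta>(1) that by (simp add: z'_def abs_mult field_simps)
    qed
    then have "(\<Sum>k<n. \<bar>real_of_int (z' k)\<bar>) \<le> (\<Sum>k<n. 1 + \<bar>v k\<bar> / \<delta>)" by (intro sum_mono) auto
    also have "\<dots> = real n + (\<Sum>k<n. \<bar>v k\<bar>) / \<delta>" by (simp add: sum.distrib sum_divide_distrib)
    also have "\<dots> \<le> real n + sqrt (real n) / \<delta>" using v_abs \<delta>(1) by (simp add: divide_right_mono)
    also have "sqrt (real n) / \<delta> = sqrt ((real n)\<^sup>2 * (2 * (T / l)))"
      by (simp add: \<delta>_def real_sqrt_divide[symmetric] power2_eq_square mult_ac)
    also have "\<dots> = real n * sqrt (2 * (T / l))" by (simp only: real_sqrt_mult[of "(real n)\<^sup>2"]) simp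
    finally show ?thesis by (simp add: algebra_simps)
  qed
  ultimately show ?thesis by blast
qed

text \<open>The probabilistic core, with feature maps \<open>f k\<close> whose mean quadratic form
  is diagonal with entries \<open>a k\<close> between \<open>l\<close> and \<open>B\<close>. The bad
  event is covered by a large trace or by a small form at one of finitely many lattice
  vectors.\<close>

lemma (in prob_space) lambda_min_lower_tail:
  fixes f :: "nat \<Rightarrow> 'x::topological_space \<Rightarrow> 'y::{real_inner, second_countable_topology}"
    and u :: "'a \<Rightarrow> 'x" and a :: "nat \<Rightarrow> real" and l B \<kappa> h :: real
  assumes n: "n > 0" and N: "N > 0" and l: "l > 0" and \<kappa>: "\<kappa> > 0" and h: "0 \<le> h" "h \<le> 1"
    and a: "\<And>k. k < n \<Longrightarrow> l \<le> a k \<and> a k \<le> B"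
    and u [measurable]: "u \<in> borel_measurable M"
    and iid: "iid_copies M u U N"
    and f [measurable]: "\<And>k. k < n \<Longrightarrow> f k \<in> borel_measurable borel"
    and mom2: "\<And>\<theta>. expectation (\<lambda>\<omega>. (norm (\<Sum>k<n. \<theta> k *\<^sub>R f k (u \<omega>)))\<^sup>2) = (\<Sum>k<n. a k * (\<theta> k)\<^sup>2)"
    and int4: "\<And>\<theta>. integrable M (\<lambda>\<omega>. norm (\<Sum>k<n. \<theta> k *\<^sub>R f k (u \<omega>)) ^ 4)"
    and mom4: "\<And>\<theta>. expectation (\<lambda>\<omega>. norm (\<Sum>k<n. \<theta> k *\<^sub>R f k (u \<omega>)) ^ 4)
      \<le> \<kappa> * (\<Sum>k<n. a k * (\<theta> k)\<^sup>2)\<^sup>2"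
  shows "prob {\<omega> \<in> space M. lambda_min (empirical_gram (\<lambda>m k. f k (U m \<omega>)) n N) \<le> (h - 1 / 8) * l}
    \<le> \<kappa> * B\<^sup>2 / real N + (20 * (B + 1) / l) ^ n * exp (- (real N * (1 - h)\<^sup>2 / (2 * \<kappa>)))"
proof -
  have indep: "indep_vars (\<lambda>_. borel) U {1..N}"
    and distr: "\<And>m. m \<in> {1..N} \<Longrightarrow> distr M borel (U m) = distr M borel u"
    using iid by (auto simp: iid_copies_def)
  have U [measurable]: "U m \<in> borel_measurable M" if "m \<in> {1..N}" for m
    using indep that by (auto simp: indep_vars_def)
  \<comment> \<open>Equality of laws carries moments of \<open>u\<close> over to each
    sample.\<close>
  have transfer: "integrable M (\<lambda>\<omega>. g (U m \<omega>)) \<longleftrightarrow> integrable M (\<lambda>\<omega>. g (u \<omega>))"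
      "expectation (\<lambda>\<omega>. g (U m \<omega>)) = expectation (\<lambda>\<omega>. g (u \<omega>))"
    if m: "m \<in> {1..N}" and g: "g \<in> borel_measurable borel" for m and g :: "'x \<Rightarrow> real"
    using integrable_distr_eq[OF U[OF m] g] integrable_distr_eq[OF u g]
      integral_distr[OF U[OF m] g] integral_distr[OF u g] distr[OF m] by simp_all
  have lB: "l \<le> B" using a[of 0] n by auto
  define T where "T = B + 1"
  have T: "T > 0" using l lB by (simp add: T_def)

  \<comment> \<open>Lower tail of the empirical form at a fixed vector\<close>
  define S where "S \<theta> x = (norm (\<Sum>k<n. \<theta> k *\<^sub>R f k x))\<^sup>2" for \<theta> x
  have S_meas [measurable]: "S \<theta> \<in> borel_measurable borel" for \<theta>
    unfolding S_def by measurable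
  have S2: "(S \<theta> x)\<^sup>2 = norm (\<Sum>k<n. \<theta> k *\<^sub>R f k x) ^ 4" for \<theta> x
    by (simp add: S_def)
  have S_nonneg: "S \<theta> x \<ge> 0" for \<theta> x by (simp add: S_def)
  define \<mu> where "\<mu> \<theta> = (\<Sum>k<n. a k * (\<theta> k)\<^sup>2)" for \<theta>
  have S_mom: "expectation (\<lambda>\<omega>. S \<theta> (u \<omega>)) = \<mu> \<theta>" "integrable M (\<lambda>\<omega>. (S \<theta> (u \<omega>))\<^sup>2)"
    "expectation (\<lambda>\<omega>. (S \<theta> (u \<omega>))\<^sup>2) \<le> \<kappa> * (\<mu> \<theta>)\<^sup>2" for \<theta>
    using mom2[of \<theta>] int4[of \<theta>] mom4[of \<theta>] unfolding S2 S_def \<mu>_def by auto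
  have S_int: "integrable M (\<lambda>\<omega>. S \<theta> (u \<omega>))" for \<theta>
    by (rule square_integrable_imp_integrable) (use S_mom(2) in measurable)

  have lower: "prob {\<omega> \<in> space M. (\<Sum>m=1..N. S \<theta> (U m \<omega>)) \<le> real N * (h * \<mu> \<theta>)}
      \<le> exp (- (real N * (1 - h)\<^sup>2 / (2 * \<kappa>)))" if pos: "\<mu> \<theta> > 0" for \<theta>
  proof -
    have "indep_vars (\<lambda>_. borel) (\<lambda>m \<omega>. S \<theta> (U m \<omega>)) {1..N}"
      by (rule indep_vars_compose2[OF indep]) measurable
    from lower_tail_indep_sum_nonneg[OF _ this, of "\<mu> \<theta>" \<kappa> h] show ?thesis
      using pos \<kappa> h S_nonneg S_mom[of \<theta>] transfer(1)[of _ "\<lambda>x. (S \<theta> x)\<^sup>2"]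
        transfer(2)[of _ "\<lambda>x. (S \<theta> x)\<^sup>2"] transfer(2)[of _ "S \<theta>"]
      by simp
  qed

  \<comment> \<open>Upper tail of the trace\<close>
  define e where "e k = (\<lambda>j. if j = k then 1 else 0 :: real)" for k :: nat
  define tr where "tr x = (\<Sum>k<n. S (e k) x)" for x
  have S_e: "S (e k) x = (norm (f k x))\<^sup>2" "\<mu> (e k) = a k" if "k < n" for k x
    using that by (simp_all add: S_def \<mu>_def e_def if_distrib[of "\<lambda>c. c *\<^sub>R _"]
        if_distrib[of "\<lambda>c. c\<^sup>2"] if_distrib[of "\<lambda>c. _ * c"] cong: if_cong)
  define \<Lambda> where "\<Lambda> = (\<Sum>k<n. a k)"
  have apos: "a k > 0" if "k < n" for k using a[OF that] l by auto
  have \<Lambda>: "0 \<le> \<Lambda>" "\<Lambda> \<le> real n * B"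
    unfolding \<Lambda>_def using a apos less_imp_le
    by (blast intro!: sum_nonneg) (use sum_bounded_above[of "{..<n}" a B] a in simp)
  have tr_meas [measurable]: "tr \<in> borel_measurable borel" unfolding tr_def by measurable
  \<comment> \<open>Cauchy-Schwarz with weights \<open>a k\<close>. Since \<open>S (e k)\<close> has
    second moment at most \<open>\<kappa> * (a k)\<^sup>2\<close>, the second moment of the trace is
    at most \<open>\<kappa> * \<Lambda>\<^sup>2\<close>.\<close>
  have tr_sq_le: "(tr x)\<^sup>2 \<le> \<Lambda> * (\<Sum>k<n. (S (e k) x)\<^sup>2 / a k)" for x
  proof -
    have "tr x = (\<Sum>k<n. sqrt (a k) * (S (e k) x / sqrt (a k)))"
      unfolding tr_def using apos by (intro sum.cong) (auto simp: less_imp_neq[symmetric])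
    then have "(tr x)\<^sup>2 \<le> (\<Sum>k<n. (sqrt (a k))\<^sup>2) * (\<Sum>k<n. (S (e k) x / sqrt (a k))\<^sup>2)"
      by (simp only: Cauchy_Schwarz_ineq_sum)
    also have "\<dots> = \<Lambda> * (\<Sum>k<n. (S (e k) x)\<^sup>2 / a k)"
      using apos by (simp add: \<Lambda>_def power_divide less_imp_le)
    finally show ?thesis .
  qed
  have bound_int: "integrable M (\<lambda>\<omega>. \<Lambda> * (\<Sum>k<n. (S (e k) (u \<omega>))\<^sup>2 / a k))"
    using S_mom(2) by auto
  have tr_int2: "integrable M (\<lambda>\<omega>. (tr (u \<omega>))\<^sup>2)"
    using bound_int
  proof (rule Bochner_Integration.integrable_bound)
    show "AE \<omega> in M. norm ((tr (u \<omega>))\<^sup>2) \<le> norm (\<Lambda> * (\<Sum>k<n. (S (e k) (u \<omega>))\<^sup>2 / a k))"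
      using tr_sq_le by (auto intro: order_trans[OF _ abs_ge_self])
  qed measurable
  have "expectation (\<lambda>\<omega>. (tr (u \<omega>))\<^sup>2) \<le> expectation (\<lambda>\<omega>. \<Lambda> * (\<Sum>k<n. (S (e k) (u \<omega>))\<^sup>2 / a k))"
    using tr_int2 bound_int tr_sq_le by (rule integral_mono)
  also have "\<dots> = \<Lambda> * (\<Sum>k<n. expectation (\<lambda>\<omega>. (S (e k) (u \<omega>))\<^sup>2) / a k)"
    using S_mom(2) by simp
  also have "\<dots> \<le> \<Lambda> * (\<Sum>k<n. \<kappa> * a k)"
  proof (intro mult_left_mono sum_mono \<Lambda>(1))
    fix k assume "k \<in> {..<n}"
    then have "expectation (\<lambda>\<omega>. (S (e k) (u \<omega>))\<^sup>2) \<le> \<kappa> * a k * a k" "a k > 0"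
      using S_mom(3)[of "e k"] S_e(2)[of k] apos by (auto simp: power2_eq_square mult.assoc)
    then show "expectation (\<lambda>\<omega>. (S (e k) (u \<omega>))\<^sup>2) / a k \<le> \<kappa> * a k"
      by (simp add: pos_divide_le_eq)
  qed
  also have "\<dots> = \<kappa> * \<Lambda>\<^sup>2" by (simp add: \<Lambda>_def sum_distrib_left[symmetric] power2_eq_square)
  also have "\<dots> \<le> \<kappa> * (real n * B)\<^sup>2"
    using \<kappa> \<Lambda> by (intro mult_left_mono power_mono) auto
  finally have tr_mom2: "expectation (\<lambda>\<omega>. (tr (u \<omega>))\<^sup>2) \<le> \<kappa> * (real n * B)\<^sup>2" .
  have tr_mom: "expectation (\<lambda>\<omega>. tr (u \<omega>)) = \<Lambda>"
    unfolding tr_def using S_int S_mom(1) S_e(2) by (simp add: \<Lambda>_def)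
  \<comment> \<open>The deviation \<open>n\<close> cancels the factor \<open>n\<^sup>2\<close> of
    the second moment.\<close>
  have upper: "prob {\<omega> \<in> space M. (\<Sum>m=1..N. tr (U m \<omega>)) \<ge> real N * (\<Lambda> + real n)} \<le> \<kappa> * B\<^sup>2 / real N"
  proof -
    have "indep_vars (\<lambda>_. borel) (\<lambda>m \<omega>. tr (U m \<omega>)) {1..N}"
      by (rule indep_vars_compose2[OF indep]) measurable
    from Chebyshev_indep_sum_upper[OF _ this, of \<Lambda> "\<kappa> * (real n * B)\<^sup>2" "real n"]
    have "prob {\<omega> \<in> space M. (\<Sum>m=1..N. tr (U m \<omega>)) \<ge> real N * (\<Lambda> + real n)}
        \<le> \<kappa> * (real n * B)\<^sup>2 / (real N * (real n)\<^sup>2)"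
      using n N tr_int2 tr_mom tr_mom2 transfer(1)[of _ "\<lambda>x. (tr x)\<^sup>2"]
        transfer(2)[of _ "\<lambda>x. (tr x)\<^sup>2"] transfer(2)[of _ tr]
      by simp
    then show ?thesis using n by (simp add: power_mult_distrib)
  qed

  \<comment> \<open>Size of the set of lattice vectors\<close>
  define \<delta> where "\<delta> = sqrt (l / (2 * real n * T))"
  have \<delta>: "\<delta> > 0" using n l T by (simp add: \<delta>_def)
  define r where "r = 1 + sqrt (2 * (T / l))"
  define F where "F = {z \<in> {..<n} \<rightarrow>\<^sub>E (UNIV :: int set).
    (\<Sum>k<n. \<bar>real_of_int (z k)\<bar>) \<le> real n * r \<and> (\<exists>k<n. z k \<noteq> 0)}"
  let ?G = "{z \<in> {..<n} \<rightarrow>\<^sub>E (UNIV :: int set). (\<Sum>k<n. \<bar>real_of_int (z k)\<bar>) \<le> real n * r}"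
  have fin: "finite ?G" by (rule finite_PiE_abs_sum_le) simp
  have FG: "F \<subseteq> ?G" by (auto simp: F_def)
  then have finF: "finite F" using fin by (rule finite_subset)
  have "T / l \<ge> 1" using l lB by (simp add: T_def)
  have card_F: "real (card F) \<le> (20 * (B + 1) / l) ^ n"
  proof -
    have "r > 0" using \<open>T / l \<ge> 1\<close> by (simp add: r_def add_pos_nonneg)
    have "real (card F) \<le> real (card ?G)" using card_mono[OF fin FG] by simp
    also have "\<dots> \<le> (exp 1 * (2 * r + 1)) ^ n" by (rule card_PiE_abs_sum_le[OF \<open>r > 0\<close>])
    also have "\<dots> \<le> (20 * (T / l)) ^ n"
    proof (rule power_mono)
      \<comment> \<open>As \<open>T / l >= 1\<close>, both summands of
        \<open>2 * r + 1 = 3 + 2 * sqrt (2 * (T / l))\<close> are at most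
        \<open>3 * (T / l)\<close>. With \<open>exp 1 <= 3\<close> this gives the factor 18, which
        is relaxed to 20.\<close>
      have "2 * (T / l) \<le> (3 / 2 * (T / l))\<^sup>2"
        using \<open>T / l \<ge> 1\<close> mult_left_mono[of 1 "T / l" "T / l"] by (simp add: power_mult_distrib power2_eq_square)
      then have "sqrt (2 * (T / l)) \<le> 3 / 2 * (T / l)"
        using \<open>T / l \<ge> 1\<close> by (intro real_le_lsqrt) auto
      then have "2 * r + 1 \<le> 6 * (T / l)" using \<open>T / l \<ge> 1\<close> by (simp add: r_def)
      then have "exp 1 * (2 * r + 1) \<le> 3 * (6 * (T / l))"
        using exp_le \<open>r > 0\<close> by (intro mult_mono) auto
      then show "exp 1 * (2 * r + 1) \<le> 20 * (T / l)" using \<open>T / l \<ge> 1\<close> by simp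
    qed (use \<open>r > 0\<close> in auto)
    finally show ?thesis by (simp add: T_def)
  qed

  \<comment> \<open>Covering of the bad event and union bound\<close>
  define \<theta> where "\<theta> z k = \<delta> * real_of_int (z k)" for z :: "nat \<Rightarrow> int" and k
  have \<mu>_pos: "\<mu> (\<theta> z) > 0" if "z \<in> F" for z
  proof -
    obtain k where "k < n" "z k \<noteq> 0" using \<open>z \<in> F\<close> by (auto simp: F_def)
    then show ?thesis unfolding \<mu>_def \<theta>_def using apos \<delta>
      by (intro sum_pos2[of _ k]) (auto simp: less_imp_le)
  qed
  define X where "X = {\<omega> \<in> space M. (\<Sum>m=1..N. tr (U m \<omega>)) \<ge> real N * (\<Lambda> + real n)}"
  define Y where "Y z = {\<omega> \<in> space M. (\<Sum>m=1..N. S (\<theta> z) (U m \<omega>)) \<le> real N * (h * \<mu> (\<theta> z))}" for z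
  have X_meas: "X \<in> sets M" unfolding X_def by measurable
  have Y_meas: "Y z \<in> sets M" for z unfolding Y_def by measurable
  have "{\<omega> \<in> space M. lambda_min (empirical_gram (\<lambda>m k. f k (U m \<omega>)) n N) \<le> (h - 1 / 8) * l}
      \<subseteq> X \<union> (\<Union>z\<in>F. Y z)"
  proof
    fix \<omega> assume "\<omega> \<in> {\<omega> \<in> space M. lambda_min (empirical_gram (\<lambda>m k. f k (U m \<omega>)) n N) \<le> (h - 1 / 8) * l}"
    then have \<omega>: "\<omega> \<in> space M"
      and small: "lambda_min (empirical_gram (\<lambda>m k. f k (U m \<omega>)) n N) \<le> (h - 1 / 8) * l" by auto
    show "\<omega> \<in> X \<union> (\<Union>z\<in>F. Y z)"
    proof (cases "\<omega> \<in> X")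
      case False
      then have "(\<Sum>m=1..N. tr (U m \<omega>)) < real N * (\<Lambda> + real n)" using \<omega> by (simp add: X_def)
      \<comment> \<open>Outside \<open>X\<close> the averaged trace is below
        \<open>\<Lambda> + n <= n * (B + 1)\<close>; this is where \<open>T = B + 1\<close> comes
        from.\<close>
      also have "\<dots> \<le> real N * (real n * T)"
        using \<Lambda>(2) by (intro mult_left_mono) (auto simp: T_def algebra_simps)
      finally have "1 / real N * (\<Sum>m=1..N. \<Sum>k<n. (norm (f k (U m \<omega>)))\<^sup>2) < real n * T"
        using N by (simp add: tr_def S_e pos_divide_less_eq mult.commute)
      from lattice_witness_small_eigenvalue[OF \<delta>_def n l _ T h(1) this small, of a] obtain z where
        "z \<in> {..<n} \<rightarrow>\<^sub>E (UNIV :: int set)" "(\<Sum>k<n. \<bar>real_of_int (z k)\<bar>) \<le> real n * r" "\<exists>k<n. z k \<noteq> 0"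
        "1 / real N * (\<Sum>m=1..N. S (\<theta> z) (U m \<omega>)) \<le> h * \<mu> (\<theta> z)"
        using a unfolding S_def \<mu>_def \<theta>_def r_def by blast
      then have "z \<in> F" "\<omega> \<in> Y z"
        using \<omega> N by (auto simp: F_def Y_def pos_divide_le_eq mult.commute)
      then show ?thesis by blast
    qed simp
  qed
  then have "prob {\<omega> \<in> space M. lambda_min (empirical_gram (\<lambda>m k. f k (U m \<omega>)) n N) \<le> (h - 1 / 8) * l}
      \<le> prob (X \<union> (\<Union>z\<in>F. Y z))"
    using X_meas Y_meas finF by (intro finite_measure_mono) auto
  also have "\<dots> \<le> prob X + prob (\<Union>z\<in>F. Y z)"
    using X_meas Y_meas finF by (intro measure_Un_le) auto
  also have "prob (\<Union>z\<in>F. Y z) \<le> (\<Sum>z\<in>F. prob (Y z))"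
    using Y_meas finF by (intro finite_measure_subadditive_finite) auto
  also have "(\<Sum>z\<in>F. prob (Y z)) \<le> (\<Sum>z\<in>F. exp (- (real N * (1 - h)\<^sup>2 / (2 * \<kappa>))))"
    unfolding Y_def by (intro sum_mono lower \<mu>_pos)
  also have "\<dots> \<le> (20 * (B + 1) / l) ^ n * exp (- (real N * (1 - h)\<^sup>2 / (2 * \<kappa>)))"
    using card_F by (simp add: mult_right_mono)
  also have "prob X \<le> \<kappa> * B\<^sup>2 / real N" unfolding X_def by (rule upper)
  finally show ?thesis by simp
qed

section \<open>Eigenfunctions of the normal operator\<close>

lemma empirical_normal_matrix_eq_gram:
  "empirical_normal_matrix R \<psi> v n M = empirical_gram (\<lambda>m k. R (\<psi> (Suc k)) (v m)) n M"
  by (simp add: empirical_normal_matrix_def empirical_gram_def)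

text \<open>At a unit eigenvector the eigenvalue is an average of squared norms. This empties the
  event in the theorem when its threshold is negative.\<close>

lemma lambda_min_empirical_gram_nonneg:
  fixes Y :: "nat \<Rightarrow> nat \<Rightarrow> 'y::real_inner"
  assumes "n > 0"
  shows "lambda_min (empirical_gram Y n M) \<ge> 0"
proof -
  obtain v :: "nat \<Rightarrow> real" where
    "1 / real M * (\<Sum>m=1..M. (norm (\<Sum>k<n. v k *\<^sub>R Y m k))\<^sup>2) = lambda_min (empirical_gram Y n M)"
    using assms by (rule lambda_min_empirical_gram_attained)
  moreover have "0 \<le> 1 / real M * (\<Sum>m=1..M. (norm (\<Sum>k<n. v k *\<^sub>R Y m k))\<^sup>2)"
    by (simp add: sum_nonneg)
  ultimately show ?thesis by simp
qed

lemma L2_linear_combination: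
  assumes f: "f \<in> L2 \<rho>" and g: "g \<in> L2 \<rho>"
  shows "(\<lambda>x. a * f x + b * g x) \<in> L2 \<rho>"
proof -
  have [measurable]: "f \<in> borel_measurable \<rho>" "g \<in> borel_measurable \<rho>"
    using f g by (auto simp: L2_def)
  have "integrable \<rho> (\<lambda>x. 2 * a\<^sup>2 * (f x)\<^sup>2 + 2 * b\<^sup>2 * (g x)\<^sup>2)"
    using f g by (auto simp: L2_def)
  then have "integrable \<rho> (\<lambda>x. (a * f x + b * g x)\<^sup>2)"
  proof (rule Bochner_Integration.integrable_bound)
    have "(a * s + b * t)\<^sup>2 \<le> 2 * a\<^sup>2 * s\<^sup>2 + 2 * b\<^sup>2 * t\<^sup>2" for s t
      using zero_le_power2[of "a * s - b * t"] by (simp add: power2_eq_square algebra_simps)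
    then show "AE x in \<rho>. norm ((a * f x + b * g x)\<^sup>2) \<le> norm (2 * a\<^sup>2 * (f x)\<^sup>2 + 2 * b\<^sup>2 * (g x)\<^sup>2)"
      by (auto intro: order_trans[OF _ abs_ge_self])
  qed measurable
  then show ?thesis by (simp add: L2_def)
qed

lemma forward_operator_sum:
  fixes \<psi> :: "nat \<Rightarrow> 'a \<Rightarrow> real"
  assumes R: "forward_operator \<rho> R" and \<psi>: "\<And>k. k \<le> n \<Longrightarrow> \<psi> k \<in> L2 \<rho>"
  shows "(\<lambda>x. \<Sum>k<n. \<theta> k * \<psi> k x) \<in> L2 \<rho> \<and>
    R (\<lambda>x. \<Sum>k<n. \<theta> k * \<psi> k x) v = (\<Sum>k<n. \<theta> k *\<^sub>R R (\<psi> k) v)"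
proof -
  have lin: "R (\<lambda>x. a * f x + b * g x) v = a *\<^sub>R R f v + b *\<^sub>R R g v"
    if "f \<in> L2 \<rho>" "g \<in> L2 \<rho>" for f g a b
    by (rule R[unfolded forward_operator_def, THEN conjunct2, THEN conjunct2, rule_format, OF that])
  show ?thesis
    using \<psi>
  proof (induction n)
    \<comment> \<open>The hypothesis covers \<open>k <= n\<close>, so \<open>\<psi> 0\<close> is
      available here and the zero function can be written as
      \<open>0 * \<psi> 0 + 0 * \<psi> 0\<close>.\<close>
    case 0
    show ?case
      using lin[of "\<psi> 0" "\<psi> 0" 0 0] L2_linear_combination[of "\<psi> 0" \<rho> "\<psi> 0" 0 0] 0[of 0] by simp
  next
    case (Suc n)
    let ?f = "\<lambda>x. \<Sum>k<n. \<theta> k * \<psi> k x"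
    have IH: "?f \<in> L2 \<rho>" "R ?f v = (\<Sum>k<n. \<theta> k *\<^sub>R R (\<psi> k) v)" and \<psi>: "\<psi> n \<in> L2 \<rho>"
      using Suc by auto
    have "(\<lambda>x. 1 * ?f x + \<theta> n * \<psi> n x) \<in> L2 \<rho>"
      by (rule L2_linear_combination[OF IH(1) \<psi>])
    then show ?case using lin[OF IH(1) \<psi>, of 1 "\<theta> n"] IH(2) by simp
  qed
qed

text \<open>The coefficients \<open>c\<close>, shifted to start at index 1, have finite support: the
  partial sums are constant from \<open>n\<close> on and the weighted series is finite, whatever
  \<open>\<beta>\<close> is.\<close>

lemma finite_combination_in_H_space:
  assumes "(\<lambda>x. \<Sum>k<n. \<theta> k * \<psi> (Suc k) x) \<in> L2 \<rho>"
  shows "(\<lambda>x. \<Sum>k<n. \<theta> k * \<psi> (Suc k) x) \<in> H_space \<rho> lam \<psi> \<beta>"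
proof -
  define c where "c k = (if k \<in> {1..n} then \<theta> (k - 1) else 0)" for k
  have part: "(\<Sum>k=1..N. c k * \<psi> k x) = (\<Sum>k<n. \<theta> k * \<psi> (Suc k) x)" if "N \<ge> n" for N x
  proof -
    have "(\<Sum>k=1..N. c k * \<psi> k x) = (\<Sum>k=1..n. c k * \<psi> k x)"
      using that by (intro sum.mono_neutral_right) (auto simp: c_def)
    also have "\<dots> = (\<Sum>k<n. \<theta> k * \<psi> (Suc k) x)"
      by (rule sum.reindex_bij_witness[of _ Suc "\<lambda>k. k - 1"]) (auto simp: c_def)
    finally show ?thesis .
  qed
  have "(\<lambda>N. L2_norm \<rho> (\<lambda>x. (\<Sum>k<n. \<theta> k * \<psi> (Suc k) x) - (\<Sum>k=1..N. c k * \<psi> k x))) \<longlonglongrightarrow> 0"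
  proof (rule tendsto_eventually, rule eventually_sequentiallyI)
    fix N assume "n \<le> N"
    then show "L2_norm \<rho> (\<lambda>x. (\<Sum>k<n. \<theta> k * \<psi> (Suc k) x) - (\<Sum>k=1..N. c k * \<psi> k x)) = 0"
      by (simp only: part) (simp add: L2_norm_def L2_inner_def)
  qed
  moreover have "(\<lambda>k. lam k powr (- \<beta>) * (c k)\<^sup>2) summable_on {1..}"
    by (rule summable_on_cong_neutral[THEN iffD1, OF _ _ _ summable_on_finite, of _ "{1..n}"])
      (auto simp: c_def)
  ultimately show ?thesis using assms by (auto simp: H_space_def)
qed

text \<open>The mean inner product is the \<open>L2\<close> inner product of
  \<open>L (\<psi> k)\<close> with \<open>\<psi> l\<close>; the almost-everywhere eigenvalue
  equation and orthonormality evaluate it. Hence the images of the eigenfunctions are orthogonal in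
  mean, and the mean Gram matrix is diagonal.\<close>

lemma normal_operator_eigenfunctions:
  assumes L: "normal_operator P u \<rho> R L" and eig: "positive_eigensystem \<rho> L lam \<psi>"
    and kl: "k \<ge> 1" "l \<ge> 1"
  shows "integrable P (\<lambda>\<omega>. inner (R (\<psi> k) (u \<omega>)) (R (\<psi> l) (u \<omega>)))"
    and "(\<integral>\<omega>. inner (R (\<psi> k) (u \<omega>)) (R (\<psi> l) (u \<omega>)) \<partial>P) = (if k = l then lam k else 0)"
proof -
  have \<psi>: "\<psi> k \<in> L2 \<rho>" "\<psi> l \<in> L2 \<rho>" and ae: "AE x in \<rho>. L (\<psi> k) x = lam k * \<psi> k x"
    and ortho: "L2_inner \<rho> (\<psi> k) (\<psi> l) = (if k = l then 1 else 0)"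
    using eig kl by (auto simp: positive_eigensystem_def)
  have "L (\<psi> k) \<in> L2 \<rho>" using L \<psi> by (auto simp: normal_operator_def L2_operator_def)
  then have [measurable]: "\<psi> k \<in> borel_measurable \<rho>" "\<psi> l \<in> borel_measurable \<rho>" "L (\<psi> k) \<in> borel_measurable \<rho>"
    using \<psi> by (auto simp: L2_def)
  show "integrable P (\<lambda>\<omega>. inner (R (\<psi> k) (u \<omega>)) (R (\<psi> l) (u \<omega>)))"
    using L \<psi> by (auto simp: normal_operator_def)
  have "(\<integral>\<omega>. inner (R (\<psi> k) (u \<omega>)) (R (\<psi> l) (u \<omega>)) \<partial>P) = L2_inner \<rho> (L (\<psi> k)) (\<psi> l)"
    using L \<psi> by (auto simp: normal_operator_def)
  also have "\<dots> = (\<integral>x. lam k * (\<psi> k x * \<psi> l x) \<partial>\<rho>)"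
    unfolding L2_inner_def using ae by (intro integral_cong_AE) (auto elim!: eventually_mono)
  also have "\<dots> = lam k * L2_inner \<rho> (\<psi> k) (\<psi> l)" by (simp add: L2_inner_def)
  finally show "(\<integral>\<omega>. inner (R (\<psi> k) (u \<omega>)) (R (\<psi> l) (u \<omega>)) \<partial>P) = (if k = l then lam k else 0)"
    by (simp add: ortho)
qed

lemma normal_operator_second_moment:
  fixes R :: "('a \<Rightarrow> real) \<Rightarrow> 'x \<Rightarrow> 'y::{real_inner, banach, second_countable_topology}"
  assumes L: "normal_operator P u \<rho> R L" and eig: "positive_eigensystem \<rho> L lam \<psi>"
  shows "(\<integral>\<omega>. (norm (\<Sum>k<n. \<theta> k *\<^sub>R R (\<psi> (Suc k)) (u \<omega>)))\<^sup>2 \<partial>P) = (\<Sum>k<n. lam (Suc k) * (\<theta> k)\<^sup>2)"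
proof -
  let ?f = "\<lambda>k \<omega>. R (\<psi> (Suc k)) (u \<omega>)"
  note ev = normal_operator_eigenfunctions[OF L eig]
  have "(norm (\<Sum>k<n. \<theta> k *\<^sub>R ?f k \<omega>))\<^sup>2 = (\<Sum>k<n. \<Sum>l<n. \<theta> k * \<theta> l * inner (?f k \<omega>) (?f l \<omega>))" for \<omega>
    unfolding power2_norm_eq_inner inner_sum_left inner_scaleR_left
    by (simp add: inner_sum_right sum_distrib_left mult.assoc)
  then have "(\<integral>\<omega>. (norm (\<Sum>k<n. \<theta> k *\<^sub>R ?f k \<omega>))\<^sup>2 \<partial>P)
      = (\<Sum>k<n. \<Sum>l<n. \<theta> k * \<theta> l * (\<integral>\<omega>. inner (?f k \<omega>) (?f l \<omega>) \<partial>P))"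
    using ev(1) by (simp add: Bochner_Integration.integral_sum)
  also have "\<dots> = (\<Sum>k<n. \<Sum>l<n. if l = k then lam (Suc k) * (\<theta> k)\<^sup>2 else 0)"
    using ev(2) by (intro sum.cong refl) (simp add: power2_eq_square)
  also have "\<dots> = (\<Sum>k<n. lam (Suc k) * (\<theta> k)\<^sup>2)" by simp
  finally show ?thesis .
qed

lemma antimono_from_one:
  fixes lam :: "nat \<Rightarrow> real"
  assumes "\<And>k. 1 \<le> k \<Longrightarrow> lam (Suc k) \<le> lam k" and "1 \<le> j" "j \<le> k"
  shows "lam k \<le> lam j"
  using \<open>j \<le> k\<close>
proof (induction k rule: dec_induct)
  case (step k)
  then show ?case using assms(1)[of k] \<open>1 \<le> j\<close> by linarith
qed simp

theorem lemma3p7: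
  fixes S :: "(real ^ 'd) set"
    and \<rho> :: "(real ^ 'd) measure"
    and P :: "'w measure"
    and R :: "(real ^ 'd \<Rightarrow> real) \<Rightarrow> 'x::banach \<Rightarrow>
                'y::{real_inner, banach, second_countable_topology}"
    and u :: "'w \<Rightarrow> 'x"
    and U :: "nat \<Rightarrow> 'w \<Rightarrow> 'x"
    and L :: "(real ^ 'd \<Rightarrow> real) \<Rightarrow> (real ^ 'd \<Rightarrow> real)"
    and lam :: "nat \<Rightarrow> real"
    and \<psi> :: "nat \<Rightarrow> real ^ 'd \<Rightarrow> real"
    and \<beta> \<kappa> :: real
    and n M :: nat
  assumes "compact S"
    and "sets \<rho> = sets (restrict_space borel S)"
    and "prob_space P"
    and "u \<in> borel_measurable P"
    and "forward_operator \<rho> R"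
    and "normal_operator P u \<rho> R L"
    and "L2_nonnegative \<rho> L"
    and "L2_self_adjoint \<rho> L"
    and "L2_compact \<rho> L"
    and "positive_eigensystem \<rho> L lam \<psi>"
    and "polynomial_decay lam \<or> exponential_decay lam"
    and "\<beta> \<ge> 0"
    and "\<kappa> \<ge> 1"
    and "fourth_moment_condition P u R (H_space \<rho> lam \<psi> \<beta>) \<kappa>"
    and "n \<ge> 1"
    and "M \<ge> 1"
    and "iid_copies P u U M"
  shows "(\<forall>\<epsilon>>0. measure P {\<omega> \<in> space P.
              lambda_min (empirical_normal_matrix R \<psi> (\<lambda>m. U m \<omega>) n M) \<le> (3 - \<epsilon>) / 8 * lam n}
            \<le> \<kappa> * (lam 1)\<^sup>2 / real M
              + exp (real n * ln (20 * (lam 1 + 1) / lam n)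
                     - \<epsilon> * real M * lam n / (4 * \<kappa> * (lam n + lam 1)))) \<and>
         measure P {\<omega> \<in> space P.
              lambda_min (empirical_normal_matrix R \<psi> (\<lambda>m. U m \<omega>) n M) \<le> lam n / 4}
            \<le> \<kappa> * (lam 1)\<^sup>2 / real M
              + exp (real n * ln (20 * (lam 1 + 1) / lam n)
                     - real M * lam n / (4 * \<kappa> * (lam n + lam 1)))"
proof -
  interpret prob_space P by fact
  note es = assms(10)[unfolded positive_eigensystem_def]
  have eig: "0 < lam k" "lam (Suc k) \<le> lam k" "\<psi> k \<in> L2 \<rho>" if "k \<ge> 1" for k
    using that es[THEN conjunct1, rule_format, of k] es[THEN conjunct2, THEN conjunct1, rule_format, of k]
    by blast+
  have anti: "lam k \<le> lam j" if "1 \<le> j" "j \<le> k" for j k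
    using eig(2) that by (rule antimono_from_one)
  have pos: "0 < lam n" "0 < lam 1" "lam n \<le> lam 1" using eig(1)[of n] eig(1)[of 1] anti[of 1 n] assms(15) by auto
  define f where "f k = R (\<psi> (Suc k))" for k
  have f_meas: "f k \<in> borel_measurable borel" for k
    using assms(5)[unfolded forward_operator_def, THEN conjunct1] eig(3)[of "Suc k"] by (simp add: f_def)
  \<comment> \<open>By linearity of \<open>R\<close> the vector sum is the image of one finite
    combination of eigenfunctions, which lies in \<open>H_space\<close>, so the fourth-moment
    condition applies to it.\<close>
  have fourth: "integrable P (\<lambda>\<omega>. norm (\<Sum>k<n. \<theta> k *\<^sub>R f k (u \<omega>)) ^ 4) \<and>
      expectation (\<lambda>\<omega>. norm (\<Sum>k<n. \<theta> k *\<^sub>R f k (u \<omega>)) ^ 4) \<le> \<kappa> * (\<Sum>k<n. lam (Suc k) * (\<theta> k)\<^sup>2)\<^sup>2" for \<theta>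
  proof -
    let ?\<phi> = "\<lambda>x. \<Sum>k<n. \<theta> k * \<psi> (Suc k) x"
    have \<phi>: "?\<phi> \<in> L2 \<rho>" "\<And>v. R ?\<phi> v = (\<Sum>k<n. \<theta> k *\<^sub>R f k v)"
      using forward_operator_sum[OF assms(5), where \<psi> = "\<lambda>k. \<psi> (Suc k)" and n = n and \<theta> = \<theta>] eig(3)
      by (simp_all add: f_def)
    have "expectation (\<lambda>\<omega>. (norm (R ?\<phi> (u \<omega>)))\<^sup>2) = (\<Sum>k<n. lam (Suc k) * (\<theta> k)\<^sup>2)"
      unfolding \<phi>(2) f_def by (rule normal_operator_second_moment[OF assms(6,10)])
    with bspec[OF assms(14)[unfolded fourth_moment_condition_def] finite_combination_in_H_space[OF \<phi>(1)]]
    show ?thesis by (simp only: \<phi>(2))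
  qed
  let ?ev = "\<lambda>t. {\<omega> \<in> space P. lambda_min (empirical_normal_matrix R \<psi> (\<lambda>m. U m \<omega>) n M) \<le> t}"
  have bound: "prob (?ev ((3 - \<epsilon>) / 8 * lam n))
      \<le> \<kappa> * (lam 1)\<^sup>2 / real M + exp (real n * ln (20 * (lam 1 + 1) / lam n)
           - \<epsilon> * real M * lam n / (4 * \<kappa> * (lam n + lam 1)))" if \<epsilon>: "\<epsilon> > 0" for \<epsilon>
  \<comment> \<open>For \<open>\<epsilon> > 3\<close> the threshold is negative and the event is
    empty; otherwise \<open>h >= 1 / 8\<close>, as the tail bound requires
    \<open>h >= 0\<close>.\<close>
  proof (cases "\<epsilon> > 3")
    case True
    then have "(3 - \<epsilon>) / 8 * lam n < 0" using pos by (intro mult_neg_pos) auto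
    moreover have "0 \<le> lambda_min (empirical_normal_matrix R \<psi> v n M)" for v
      unfolding empirical_normal_matrix_eq_gram
      using assms(15) by (intro lambda_min_empirical_gram_nonneg) simp
    ultimately have "\<not> lambda_min (empirical_normal_matrix R \<psi> v n M) \<le> (3 - \<epsilon>) / 8 * lam n" for v
      by (meson not_le order_less_le_trans)
    then have empty: "?ev ((3 - \<epsilon>) / 8 * lam n) = {}" by blast
    show ?thesis unfolding empty using assms(13) by (simp add: add_nonneg_nonneg)
  next
    case False
    define h where "h = (4 - \<epsilon>) / 8"
    have h: "0 \<le> h" "h \<le> 1" "(3 - \<epsilon>) / 8 = h - 1 / 8" "1 - h = (4 + \<epsilon>) / 8"
      using \<epsilon> False by (auto simp: h_def field_simps)
    have ev: "?ev ((3 - \<epsilon>) / 8 * lam n)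
        = {\<omega> \<in> space P. lambda_min (empirical_gram (\<lambda>m k. f k (U m \<omega>)) n M) \<le> (h - 1 / 8) * lam n}"
      by (simp add: empirical_normal_matrix_eq_gram f_def h(3))
    have "prob (?ev ((3 - \<epsilon>) / 8 * lam n)) \<le> \<kappa> * (lam 1)\<^sup>2 / real M
        + (20 * (lam 1 + 1) / lam n) ^ n * exp (- (real M * (1 - h)\<^sup>2 / (2 * \<kappa>)))"
      unfolding ev
    proof (rule lambda_min_lower_tail)
      show "lam n \<le> lam (Suc k) \<and> lam (Suc k) \<le> lam 1" if "k < n" for k
        using anti that by auto
      show "expectation (\<lambda>\<omega>. (norm (\<Sum>k<n. \<theta> k *\<^sub>R f k (u \<omega>)))\<^sup>2) = (\<Sum>k<n. lam (Suc k) * (\<theta> k)\<^sup>2)" for \<theta>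
        unfolding f_def by (rule normal_operator_second_moment[OF assms(6,10)])
    qed (use assms(4,13,15,16,17) pos h fourth f_meas in auto)
    also have "(20 * (lam 1 + 1) / lam n) ^ n = exp (real n * ln (20 * (lam 1 + 1) / lam n))"
      using pos by (simp add: exp_of_nat_mult)
    also have "\<dots> * exp (- (real M * (1 - h)\<^sup>2 / (2 * \<kappa>)))
        = exp (real n * ln (20 * (lam 1 + 1) / lam n) - real M * (1 - h)\<^sup>2 / (2 * \<kappa>))"
      by (simp add: exp_add[symmetric])
    also have "\<dots> \<le> exp (real n * ln (20 * (lam 1 + 1) / lam n)
           - \<epsilon> * real M * lam n / (4 * \<kappa> * (lam n + lam 1)))"
    proof -
      \<comment> \<open>Equivalent to \<open>16 * \<epsilon> <= (4 + \<epsilon>)\<^sup>2\<close>,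
        that is, to \<open>0 <= (4 - \<epsilon>)\<^sup>2\<close>.\<close>
      have "\<epsilon> / 4 \<le> (1 - h)\<^sup>2"
        using zero_le_power2[of "4 - \<epsilon>"] by (simp add: h(4) power2_eq_square field_simps)
      have "\<epsilon> * real M * lam n / (4 * \<kappa> * (lam n + lam 1)) = real M / (2 * \<kappa>) * (\<epsilon> / 2 * (lam n / (lam n + lam 1)))"
        by (simp add: algebra_simps)
      \<comment> \<open>Since \<open>lam n <= lam 1\<close>, the quotient
        \<open>lam n / (lam n + lam 1)\<close> is at most one half.\<close>
      also have "\<dots> \<le> real M / (2 * \<kappa>) * (\<epsilon> / 2 * (1 / 2))"
        using pos \<epsilon> assms(13) by (intro mult_left_mono) (auto simp: field_simps)
      also have "\<dots> \<le> real M / (2 * \<kappa>) * (1 - h)\<^sup>2"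
        using \<open>\<epsilon> / 4 \<le> (1 - h)\<^sup>2\<close> assms(13) by (intro mult_left_mono) auto
      finally show ?thesis by simp
    qed
    finally show ?thesis by simp
  qed
  show ?thesis
    using bound bound[of 1] by (auto simp: mult.commute)
qed

end
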